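(* Consider a linear quadratic problem with data $(A,B,H)$ for which quadratic strict $(x,u)$-pre-dissipativity holds, with $(A,B)$ controllable, and let $\bar P_{\mathrm s}$ be the stabilizing solution of the RDARE (which exists under these hypotheses). Select a symmetric terminal cost matrix $P^{\mathrm f}\succ \bar P_{\mathrm s}$. Then for any sufficiently large finite horizon $N$ (i.e. there is $N_0$ such that for all $N\ge N_0$) the receding horizon optimal control problem of horizon $N$ with stage cost $\ell$ and terminal cost $x^\top P^{\mathrm f}x$ yields a closed-loop system $$\hat x_{j+1}=A\hat x_j+Bu_0^\star=(A-BK_N)\hat x_j$$ for which the origin is globally asymptotically stable.
   Context: Data: real matrices $A\in\mathbb R^{n_x\times n_x}$, $B\in\mathbb R^{n_x\times n_u}$, and a symmetric (possibly indefinite) matrix $H=\begin{bmatrix}Q&S^\top\\ S&R\end{bmatrix}$. System: $x_{k+1}=Ax_k+Bu_k$. Stage cost: $\ell(x,u)=\begin{bmatrix}x\\ u\end{bmatrix}^\top H\begin{bmatrix}x\\ u\end{bmatrix}$. For symmetric $\Lambda\in\mathbb R^{n_x\times n_x}$ the rotated cost matrix is $H_\Lambda=\begin{bmatrix}Q+\Lambda-A^\top\Lambda A & S^\top-A^\top\Lambda B\\ S-B^\top\Lambda A& R-B^\top\Lambda B\end{bmatrix}$. Quadratic strict $(x,u)$-pre-dissipativity holds if there is a symmetric $\Lambda$ with $H_\Lambda\succ0$. Receding horizon control of horizon $N$: at each time $j$ minimize $\sum_{k=0}^{N-1}\ell(x_k,u_k)+x_N^\top P^{\mathrm f}x_N$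 subject to $x_0=\hat x_j$, $x_{k+1}=Ax_k+Bu_k$, and apply the first optimal input $u_0^\star$. It is given by $u_0^\star=-K_N\hat x_j$, where $P_0=P^{\mathrm f}$ and $K_{n+1}=(R+B^\top P_nB)^{-1}(S+B^\top P_nA)$, $P_{n+1}=Q+A^\top P_nA-(S^\top+A^\top P_nB)K_{n+1}$. RDARE (reverse discrete-time algebraic Riccati equation), for $A$ nonsingular: $\bar P=\bar Q+\bar A^\top\bar P\bar A-(\bar S^\top+\bar A^\top\bar P\bar B)\bar K$, $\bar K=(\bar R+\bar B^\top\bar P\bar B)^{-1}(\bar S+\bar B^\top\bar P\bar A)$, where $\bar A=A^{-1}$, $\bar B=A^{-1}B$, $\bar Q=-\bar A^\top Q\bar A$, $\bar S=S\bar A-\bar B^\top Q\bar A$, $\bar R=-R+S\bar B+\bar B^\top S^\top-\bar B^\top Q\bar B$. Its stabilizing solution $\bar P_{\mathrm s}$ is the (unique) symmetric solution for which all eigenvalues of $\bar A-\bar B\bar K$ lie strictly inside the unit circle. If $A$ is singular, the RDARE is understood as the RDARE of the pre-stabilized data, obtained by choosing $\hat K$ with $A-B\hat K$ nonsingular and replacing $A$ by $A-B\hat K$, $Q$ by $Q-S^\top\hat K-\hat K^\top S+\hat K^\top R\hat K$, $S$ by $S-R\hat K$ ($B$, $R$ unchanged). *)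

theory Defs
  imports "HOL-Analysis.Analysis"
begin

definition symmetric_matrix :: "real^'n^'n \<Rightarrow> bool" where
  "symmetric_matrix M \<longleftrightarrow> transpose M = M"

definition pos_def :: "real^'n^'n \<Rightarrow> bool" where
  "pos_def M \<longleftrightarrow> symmetric_matrix M \<and> (\<forall>x. x \<noteq> 0 \<longrightarrow> x \<bullet> (M *v x) > 0)"

definition mat_power :: "real^'n^'n \<Rightarrow> nat \<Rightarrow> real^'n^'n" where
  "mat_power A k = (((**) A) ^^ k) (mat 1)"

text \<open>Strict Schur stability; the eigenvalues of a real matrix are its complex eigenvalues.\<close>

definition schur_stable :: "real^'n^'n \<Rightarrow> bool" where
  "schur_stable M \<longleftrightarrow>
     (\<forall>(z::complex) (v::complex^'n). v \<noteq> 0 \<longrightarrow> (\<chi> i j. complex_of_real (M $ i $ j)) *v v = z *s v \<longrightarrow> cmod z < 1)"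

text \<open>Kalman rank condition: \<open>[B, A B, ..., A\<^sup>n\<^sup>-\<^sup>1 B]\<close> has full rank \<open>n\<close>, the rank being the dimension
  of the space spanned by all its columns.\<close>

definition controllable :: "real^'x^'x \<Rightarrow> real^'u^'x \<Rightarrow> bool" where
  "controllable A B \<longleftrightarrow> dim (\<Union>k<CARD('x). columns (mat_power A k ** B)) = CARD('x)"

definition stack :: "real^'x \<Rightarrow> real^'u \<Rightarrow> real^('x + 'u)" where
  "stack x u = (\<chi> i. case i of Inl a \<Rightarrow> x $ a | Inr b \<Rightarrow> u $ b)"

definition block_matrix ::
    "real^'x^'x \<Rightarrow> real^'u^'x \<Rightarrow> real^'x^'u \<Rightarrow> real^'u^'u \<Rightarrow> real^('x + 'u)^('x + 'u)" where
  "block_matrix M11 M12 M21 M22 = (\<chi> i j.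
     case i of
       Inl a \<Rightarrow> (case j of Inl c \<Rightarrow> M11 $ a $ c | Inr d \<Rightarrow> M12 $ a $ d)
     | Inr b \<Rightarrow> (case j of Inl c \<Rightarrow> M21 $ b $ c | Inr d \<Rightarrow> M22 $ b $ d))"

definition cost_matrix ::
    "real^'x^'x \<Rightarrow> real^'x^'u \<Rightarrow> real^'u^'u \<Rightarrow> real^('x + 'u)^('x + 'u)" where
  "cost_matrix Q S R = block_matrix Q (transpose S) S R"

definition stage_cost ::
    "real^'x^'x \<Rightarrow> real^'x^'u \<Rightarrow> real^'u^'u \<Rightarrow> real^'x \<Rightarrow> real^'u \<Rightarrow> real" where
  "stage_cost Q S R x u = stack x u \<bullet> (cost_matrix Q S R *v stack x u)"

definition rotated_cost_matrix ::
    "real^'x^'x \<Rightarrow> real^'u^'x \<Rightarrow> real^'x^'x \<Rightarrow> real^'x^'u \<Rightarrow> real^'u^'u \<Rightarrow> real^'x^'x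
     \<Rightarrow> real^('x + 'u)^('x + 'u)" where
  "rotated_cost_matrix A B Q S R L =
     block_matrix
       (Q + L - transpose A ** L ** A)  (transpose S - transpose A ** L ** B)
       (S - transpose B ** L ** A)      (R - transpose B ** L ** B)"

definition strictly_xu_pre_dissipative ::
    "real^'x^'x \<Rightarrow> real^'u^'x \<Rightarrow> real^'x^'x \<Rightarrow> real^'x^'u \<Rightarrow> real^'u^'u \<Rightarrow> bool" where
  "strictly_xu_pre_dissipative A B Q S R \<longleftrightarrow>
     (\<exists>L. symmetric_matrix L \<and> pos_def (rotated_cost_matrix A B Q S R L))"

text \<open>\<open>matrix_inv\<close> is unspecified on singular matrices: users of the next two operators have to state
  that \<open>R + B\<^sup>T P B\<close> is invertible.\<close>

definition riccati_gain ::
    "real^'x^'x \<Rightarrow> real^'u^'x \<Rightarrow> real^'x^'u \<Rightarrow> real^'u^'u \<Rightarrow> real^'x^'x \<Rightarrow> real^'x^'u" where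
  "riccati_gain A B S R P =
     matrix_inv (R + transpose B ** P ** B) ** (S + transpose B ** P ** A)"

definition riccati_step ::
    "real^'x^'x \<Rightarrow> real^'u^'x \<Rightarrow> real^'x^'x \<Rightarrow> real^'x^'u \<Rightarrow> real^'u^'u \<Rightarrow> real^'x^'x \<Rightarrow> real^'x^'x" where
  "riccati_step A B Q S R P =
     Q + transpose A ** P ** A - (transpose S + transpose A ** P ** B) ** riccati_gain A B S R P"

primrec riccati_iter ::
    "real^'x^'x \<Rightarrow> real^'u^'x \<Rightarrow> real^'x^'x \<Rightarrow> real^'x^'u \<Rightarrow> real^'u^'u \<Rightarrow> real^'x^'x \<Rightarrow> nat \<Rightarrow> real^'x^'x" where
  "riccati_iter A B Q S R Pf 0 = Pf"
| "riccati_iter A B Q S R Pf (Suc n) = riccati_step A B Q S R (riccati_iter A B Q S R Pf n)"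

text \<open>The gain \<open>K\<^sub>N\<close>, meaningful for \<open>N \<ge> 1\<close>.\<close>

definition horizon_gain ::
    "real^'x^'x \<Rightarrow> real^'u^'x \<Rightarrow> real^'x^'x \<Rightarrow> real^'x^'u \<Rightarrow> real^'u^'u \<Rightarrow> real^'x^'x \<Rightarrow> nat \<Rightarrow> real^'x^'u" where
  "horizon_gain A B Q S R Pf N = riccati_gain A B S R (riccati_iter A B Q S R Pf (N - 1))"

definition dare_stabilizing_solution ::
    "real^'x^'x \<Rightarrow> real^'u^'x \<Rightarrow> real^'x^'x \<Rightarrow> real^'x^'u \<Rightarrow> real^'u^'u \<Rightarrow> real^'x^'x \<Rightarrow> bool" where
  "dare_stabilizing_solution A B Q S R P \<longleftrightarrow>
     symmetric_matrix P \<and>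
     invertible (R + transpose B ** P ** B) \<and>
     P = riccati_step A B Q S R P \<and>
     schur_stable (A - B ** riccati_gain A B S R P)"

text \<open>The RDARE for nonsingular \<open>A\<close> is the DARE of the reversed data.\<close>

definition rdare_stabilizing_solution_nonsingular ::
    "real^'x^'x \<Rightarrow> real^'u^'x \<Rightarrow> real^'x^'x \<Rightarrow> real^'x^'u \<Rightarrow> real^'u^'u \<Rightarrow> real^'x^'x \<Rightarrow> bool" where
  "rdare_stabilizing_solution_nonsingular A B Q S R P \<longleftrightarrow>
     (let Ab = matrix_inv A;
          Bb = matrix_inv A ** B;
          Qb = - (transpose Ab ** Q ** Ab);
          Sb = S ** Ab - transpose Bb ** Q ** Ab;
          Rb = - R + S ** Bb + transpose Bb ** transpose S - transpose Bb ** Q ** Bb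
      in dare_stabilizing_solution Ab Bb Qb Sb Rb P)"

definition rdare_stabilizing_solution ::
    "real^'x^'x \<Rightarrow> real^'u^'x \<Rightarrow> real^'x^'x \<Rightarrow> real^'x^'u \<Rightarrow> real^'u^'u \<Rightarrow> real^'x^'x \<Rightarrow> bool" where
  "rdare_stabilizing_solution A B Q S R P \<longleftrightarrow>
     (if invertible A then rdare_stabilizing_solution_nonsingular A B Q S R P
      else \<exists>Kh :: real^'x^'u. invertible (A - B ** Kh) \<and>
             rdare_stabilizing_solution_nonsingular
               (A - B ** Kh) B
               (Q - transpose S ** Kh - transpose Kh ** S + transpose Kh ** R ** Kh)
               (S - R ** Kh) R P)"

primrec trajectory ::
    "real^'x^'x \<Rightarrow> real^'u^'x \<Rightarrow> real^'x \<Rightarrow> (nat \<Rightarrow> real^'u) \<Rightarrow> nat \<Rightarrow> real^'x" where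
  "trajectory A B x0 u 0 = x0"
| "trajectory A B x0 u (Suc k) = A *v trajectory A B x0 u k + B *v u k"

definition horizon_cost ::
    "real^'x^'x \<Rightarrow> real^'u^'x \<Rightarrow> real^'x^'x \<Rightarrow> real^'x^'u \<Rightarrow> real^'u^'u \<Rightarrow> real^'x^'x \<Rightarrow> nat
     \<Rightarrow> real^'x \<Rightarrow> (nat \<Rightarrow> real^'u) \<Rightarrow> real" where
  "horizon_cost A B Q S R Pf N x0 u =
     (\<Sum>k<N. stage_cost Q S R (trajectory A B x0 u k) (u k))
     + trajectory A B x0 u N \<bullet> (Pf *v trajectory A B x0 u N)"

text \<open>Only \<open>u 0, ..., u (N - 1)\<close> enter the cost; the later entries of an optimal \<open>u\<close> are arbitrary.\<close>

definition optimal_input ::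
    "real^'x^'x \<Rightarrow> real^'u^'x \<Rightarrow> real^'x^'x \<Rightarrow> real^'x^'u \<Rightarrow> real^'u^'u \<Rightarrow> real^'x^'x \<Rightarrow> nat
     \<Rightarrow> real^'x \<Rightarrow> (nat \<Rightarrow> real^'u) \<Rightarrow> bool" where
  "optimal_input A B Q S R Pf N x0 u \<longleftrightarrow>
     is_arg_min (horizon_cost A B Q S R Pf N x0) (\<lambda>_. True) u"

text \<open>Receding horizon closed loop: at each time apply the first input of an optimal input sequence.\<close>

definition receding_horizon_trajectory ::
    "real^'x^'x \<Rightarrow> real^'u^'x \<Rightarrow> real^'x^'x \<Rightarrow> real^'x^'u \<Rightarrow> real^'u^'u \<Rightarrow> real^'x^'x \<Rightarrow> nat
     \<Rightarrow> (nat \<Rightarrow> real^'x) \<Rightarrow> bool" where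
  "receding_horizon_trajectory A B Q S R Pf N xh \<longleftrightarrow>
     (\<forall>j. \<exists>u. optimal_input A B Q S R Pf N (xh j) u \<and> xh (Suc j) = A *v xh j + B *v u 0)"

text \<open>Global asymptotic stability of the origin, for a system given by the set of its trajectories:
  Lyapunov stability and global attractivity.\<close>

definition origin_globally_asymptotically_stable ::
    "((nat \<Rightarrow> 'a::real_normed_vector) \<Rightarrow> bool) \<Rightarrow> bool" where
  "origin_globally_asymptotically_stable traj \<longleftrightarrow>
     (\<forall>e>0. \<exists>d>0. \<forall>x. traj x \<longrightarrow> norm (x 0) < d \<longrightarrow> (\<forall>j. norm (x j) < e)) \<and>
     (\<forall>x. traj x \<longrightarrow> x \<longlonglongrightarrow> 0)"

end

theory Submission
  imports Defs "HOL-Computational_Algebra.Fundamental_Theorem_Algebra"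
begin

text \<open>
Rotating the stage cost with a dissipativity certificate \<open>L\<close> makes it positive definite and shifts every
Riccati matrix by \<open>L\<close>. Read backwards in time, the RDARE is then the equation for \<open>M = - (P + L)\<close>, the
least rotated cost of reaching a state from the origin. Controllability bounds the increasing value
iteration for \<open>M\<close>, which gives existence; as powers of a Schur stable matrix vanish, the fixed points
can be compared along each other's optimal orbits, which gives uniqueness and \<open>M > 0\<close>.

Forward in time \<open>M\<close> is a storage function: it grows by at most the rotated cost. Since \<open>Pf > Ps\<close> means
\<open>Pf + L \<ge> - (1 - d) M\<close> for some \<open>d > 0\<close>, this bound propagates through the Riccati iteration, and a
fraction \<open>d\<close> of the rotated cost remains in each value function \<open>V\<^sub>N\<close>. Hence optimal paths of length \<open>N\<close>
have uniformly bounded cost and visit a state of squared norm \<open>O(1/N)\<close>, so that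
\<open>V\<^sub>N\<^sub>+\<^sub>1 - V\<^sub>N = O(1/N)\<close>, and \<open>V\<^sub>N + (1 - d) M \<ge> 0\<close> is a Lyapunov function of the closed loop for large \<open>N\<close>.
\<close>

section \<open>Quadratic forms and completion of squares\<close>

lemma uminus_matrix_vector [simp]: "(- M) *v x = - (M *v x)" for M :: "real^'n^'m"
  using matrix_vector_mult_diff_rdistrib[of 0 M x] by simp

lemma matrix_vector_uminus [simp]: "M *v (- x) = - (M *v x)" for M :: "real^'n^'m"
  using matrix_vector_mult_diff_distrib[of M 0 x] by simp

lemma inner_vector_matrix: "x \<bullet> (y v* M) = (M *v x) \<bullet> y" for M :: "real^'n^'m"
  by (metis dot_lmul_matrix inner_commute)

lemma vector_matrix_inner: "(y v* M) \<bullet> x = (M *v x) \<bullet> y" for M :: "real^'n^'m"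
  by (metis dot_lmul_matrix inner_commute)

lemmas quadratic_form_simps =
  matrix_vector_mult_add_rdistrib matrix_vector_mult_diff_rdistrib
  matrix_vector_right_distrib matrix_vector_mult_diff_distrib
  matrix_vector_mul_assoc[symmetric]
  inner_add_left inner_add_right inner_diff_left inner_diff_right
  inner_vector_matrix vector_matrix_inner

lemma symmetric_matrix_inner:
  assumes "symmetric_matrix P"
  shows "x \<bullet> (P *v y) = (P *v x) \<bullet> y"
  using assms unfolding symmetric_matrix_def
  by (metis dot_lmul_matrix transpose_matrix_vector)

text \<open>Polarization: the bilinear form of the symmetric difference is determined by its
  quadratic form, which vanishes.\<close>

lemma symmetric_matrix_eqI:
  assumes "symmetric_matrix P" "symmetric_matrix P'" "\<And>x. x \<bullet> (P *v x) = x \<bullet> (P' *v x)"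
  shows "P = P'"
proof -
  define D where "D = P - P'"
  have q: "x \<bullet> (D *v x) = 0" for x
    by (simp add: D_def assms quadratic_form_simps)
  have s: "x \<bullet> (D *v y) = y \<bullet> (D *v x)" for x y
    using symmetric_matrix_inner[OF assms(1), of x y] symmetric_matrix_inner[OF assms(2), of x y]
    by (simp add: D_def quadratic_form_simps inner_commute[of "_ *v x" y])
  have "x \<bullet> (D *v y) = 0" for x y
    using q[of "x + y"] q[of x] q[of y] s[of x y] by (simp add: quadratic_form_simps)
  then have "\<forall>y. D *v y = 0 *v y"
    by (metis inner_eq_zero_iff matrix_vector_mult_0)
  then have "D = 0" by (simp only: matrix_eq[symmetric])
  then show ?thesis by (simp add: D_def)
qed

lemma symmetric_matrix_add: "symmetric_matrix P \<Longrightarrow> symmetric_matrix P' \<Longrightarrow> symmetric_matrix (P + P')"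
  and symmetric_matrix_diff: "symmetric_matrix P \<Longrightarrow> symmetric_matrix P' \<Longrightarrow> symmetric_matrix (P - P')"
  and symmetric_matrix_uminus: "symmetric_matrix P \<Longrightarrow> symmetric_matrix (- P)"
  by (simp_all add: symmetric_matrix_def transpose_def vec_eq_iff)

lemma
  fixes M N :: "real^'n^'m"
  shows transpose_add: "transpose (M + N) = transpose M + transpose N"
    and transpose_diff: "transpose (M - N) = transpose M - transpose N"
    and transpose_uminus: "transpose (- M) = - transpose M"
  by (simp_all add: transpose_def vec_eq_iff)

lemmas transpose_simps = transpose_add transpose_diff transpose_uminus matrix_transpose_mul

lemma symmetric_matrix_congruence:
  "symmetric_matrix P \<Longrightarrow> symmetric_matrix (transpose M ** P ** M)"
  by (simp add: symmetric_matrix_def matrix_transpose_mul matrix_mul_assoc)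

lemma matrix_inv:
  assumes "invertible M"
  shows "M ** matrix_inv M = mat 1 \<and> matrix_inv M ** M = mat 1"
  using someI_ex[OF assms[unfolded invertible_def]] by (simp add: matrix_inv_def)

lemma matrix_inv_vector:
  fixes T :: "real^'n^'n"
  assumes "invertible T"
  shows "matrix_inv T *v (T *v x) = x" "T *v (matrix_inv T *v x) = x"
  using matrix_inv[OF assms] by (simp_all add: matrix_vector_mul_assoc)

lemma symmetric_matrix_inv:
  assumes "symmetric_matrix T" "invertible T"
  shows "symmetric_matrix (matrix_inv T)"
proof -
  have "transpose (matrix_inv T) ** T = mat 1"
    using arg_cong[OF conjunct1[OF matrix_inv[OF assms(2)]], of transpose] assms(1)
    by (simp add: matrix_transpose_mul symmetric_matrix_def)
  then have "transpose (matrix_inv T) ** (T ** matrix_inv T) = matrix_inv T"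
    by (simp add: matrix_mul_assoc)
  then show ?thesis
    using matrix_inv[OF assms(2)] by (simp add: symmetric_matrix_def)
qed

text \<open>A nonvanishing form leaves no kernel. Asking only for \<open>\<noteq> 0\<close> covers
  the positive Hessians of the forward recursion as well as the negative ones of the reversed
  recursion.\<close>

lemma invertible_if_definite:
  fixes T :: "real^'n^'n"
  assumes "\<And>x. x \<noteq> 0 \<Longrightarrow> x \<bullet> (T *v x) \<noteq> 0"
  shows "invertible T"
proof -
  have "\<forall>x. T *v x = 0 \<longrightarrow> x = 0"
    using assms by (metis inner_zero_right)
  then show ?thesis
    by (simp add: invertible_left_inverse matrix_left_invertible_ker)
qed

text \<open>The stage cost without stacked vectors, so that feedback and time reversal become
  substitutions in its two arguments.\<close>

definition quadratic_cost ::
    "real^'x^'x \<Rightarrow> real^'x^'u \<Rightarrow> real^'u^'u \<Rightarrow> real^'x \<Rightarrow> real^'u \<Rightarrow> real" where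
  "quadratic_cost Q S R x u = x \<bullet> (Q *v x) + 2 * (u \<bullet> (S *v x)) + u \<bullet> (R *v u)"

lemma riccati_gain_equation:
  assumes "invertible (R + transpose B ** P ** B)"
  shows "(R + transpose B ** P ** B) *v (riccati_gain A B S R P *v x) = (S + transpose B ** P ** A) *v x"
  by (simp only: riccati_gain_def matrix_vector_mul_assoc[symmetric] matrix_inv_vector[OF assms])

lemma symmetric_riccati_step:
  assumes "symmetric_matrix Q" "symmetric_matrix R" "symmetric_matrix P"
    "invertible (R + transpose B ** P ** B)"
  shows "symmetric_matrix (riccati_step A B Q S R P)"
proof -
  let ?T = "R + transpose B ** P ** B" and ?W = "S + transpose B ** P ** A"
  have "symmetric_matrix ?T"
    by (intro symmetric_matrix_add symmetric_matrix_congruence assms)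
  then have "symmetric_matrix (matrix_inv ?T)"
    by (rule symmetric_matrix_inv) fact
  then have "symmetric_matrix (transpose ?W ** matrix_inv ?T ** ?W)"
    by (rule symmetric_matrix_congruence)
  moreover have "transpose ?W = transpose S + transpose A ** P ** B"
    using assms(3) by (simp add: transpose_simps symmetric_matrix_def matrix_mul_assoc)
  ultimately show ?thesis
    unfolding riccati_step_def riccati_gain_def
    by (intro symmetric_matrix_diff symmetric_matrix_add symmetric_matrix_congruence assms)
      (simp add: matrix_mul_assoc)
qed

text \<open>The cross terms match because the gain solves the normal equation. Invertibility of
  \<open>T\<close> takes the place of a sign condition, so the identity also serves the reversed
  data, where \<open>T\<close> turns out to be negative definite.\<close>

lemma riccati_completion_of_squares:
  fixes A :: "real^'x^'x" and B :: "real^'u^'x" and S :: "real^'x^'u"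
  assumes "symmetric_matrix R" "symmetric_matrix P" "invertible (R + transpose B ** P ** B)"
  defines "K \<equiv> riccati_gain A B S R P" and "T \<equiv> R + transpose B ** P ** B"
  shows "quadratic_cost Q S R x u + (A *v x + B *v u) \<bullet> (P *v (A *v x + B *v u)) =
    x \<bullet> (riccati_step A B Q S R P *v x) + (u + K *v x) \<bullet> (T *v (u + K *v x))"
proof -
  let ?W = "S + transpose B ** P ** A"
  have TK: "T *v (K *v x) = ?W *v x"
    unfolding T_def K_def by (rule riccati_gain_equation) fact
  have "symmetric_matrix T"
    unfolding T_def by (intro symmetric_matrix_add symmetric_matrix_congruence assms)
  then have Ts: "(K *v x) \<bullet> (T *v u) = (T *v (K *v x)) \<bullet> u"
    by (rule symmetric_matrix_inner)
  have W: "transpose S + transpose A ** P ** B = transpose ?W"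
    using assms(2) by (simp add: transpose_simps symmetric_matrix_def matrix_mul_assoc)
  have Ps: "(A *v x) \<bullet> (P *v (B *v u)) = (B *v u) \<bullet> (P *v (A *v x))"
    by (metis assms(2) inner_commute symmetric_matrix_inner)
  have 1: "(u + K *v x) \<bullet> (T *v (u + K *v x)) =
     u \<bullet> (T *v u) + 2 * (u \<bullet> (?W *v x)) + (K *v x) \<bullet> (?W *v x)"
    by (simp only: matrix_vector_right_distrib inner_add_left inner_add_right Ts TK)
       (simp add: inner_commute)
  have 2: "x \<bullet> (riccati_step A B Q S R P *v x) =
     x \<bullet> (Q *v x) + (A *v x) \<bullet> (P *v (A *v x)) - (K *v x) \<bullet> (?W *v x)"
    unfolding riccati_step_def W K_def[symmetric]
    by (simp add: quadratic_form_simps inner_commute)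
  show ?thesis
    unfolding 1 2 unfolding quadratic_cost_def T_def
    using Ps by (simp add: quadratic_form_simps inner_commute)
qed

section \<open>Block matrices and the rotated cost\<close>

lemma sum_UNIV_Plus:
  "(\<Sum>i\<in>(UNIV :: ('a::finite + 'b::finite) set). f i) = (\<Sum>a\<in>UNIV. f (Inl a)) + (\<Sum>b\<in>UNIV. f (Inr b))"
  using sum.Plus[of "UNIV :: 'a set" "UNIV :: 'b set" f] by (simp add: comp_def)

lemma stack_inner: "stack x u \<bullet> stack y v = x \<bullet> y + u \<bullet> v"
  by (simp add: inner_vec_def sum_UNIV_Plus stack_def)

lemma block_matrix_stack:
  "block_matrix M11 M12 M21 M22 *v stack x u = stack (M11 *v x + M12 *v u) (M21 *v x + M22 *v u)"
  by (simp add: vec_eq_iff matrix_vector_mult_def block_matrix_def stack_def sum_UNIV_Plus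
      split: sum.split)

lemma stage_cost_eq_quadratic_cost: "stage_cost Q S R x u = quadratic_cost Q S R x u"
  by (simp add: stage_cost_def cost_matrix_def block_matrix_stack stack_inner quadratic_cost_def
      quadratic_form_simps inner_commute)

text \<open>Along a trajectory the two \<open>L\<close> terms telescope, so rotation changes a total
  cost by boundary terms only.\<close>

lemma rotated_cost:
  assumes "symmetric_matrix L"
  shows "stack x u \<bullet> (rotated_cost_matrix A B Q S R L *v stack x u) =
    quadratic_cost Q S R x u + x \<bullet> (L *v x) - (A *v x + B *v u) \<bullet> (L *v (A *v x + B *v u))"
proof -
  have "(A *v x) \<bullet> (L *v (B *v u)) = (B *v u) \<bullet> (L *v (A *v x))"
    by (metis assms inner_commute symmetric_matrix_inner)
  then show ?thesis
    by (simp add: rotated_cost_matrix_def block_matrix_stack stack_inner quadratic_cost_def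
      quadratic_form_simps inner_commute)
qed

lemma symmetric_cost_matrix:
  assumes "symmetric_matrix (cost_matrix Q S R)"
  shows "symmetric_matrix Q" "symmetric_matrix R"
proof -
  have "transpose (cost_matrix Q S R) $ i $ j = cost_matrix Q S R $ i $ j" for i j
    using assms by (simp only: symmetric_matrix_def)
  then have *: "cost_matrix Q S R $ j $ i = cost_matrix Q S R $ i $ j" for i j
    by (simp add: transpose_def)
  have "Q $ j $ i = Q $ i $ j" for i j
    using *[of "Inl j" "Inl i"] by (simp add: cost_matrix_def block_matrix_def)
  then show "symmetric_matrix Q"
    unfolding symmetric_matrix_def transpose_def vec_eq_iff vec_lambda_beta by blast
  have "R $ j $ i = R $ i $ j" for i j
    using *[of "Inr j" "Inr i"] by (simp add: cost_matrix_def block_matrix_def)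
  then show "symmetric_matrix R"
    unfolding symmetric_matrix_def transpose_def vec_eq_iff vec_lambda_beta by blast
qed

text \<open>The form attains a positive minimum on the compact unit sphere, and homogeneity carries
  this minimum as \<open>e\<close> to all vectors.\<close>

lemma pos_def_lower_bound:
  fixes M :: "real^'n^'n"
  assumes "pos_def M"
  obtains e where "e > 0" "\<And>z. z \<bullet> (M *v z) \<ge> e * (z \<bullet> z)"
proof -
  let ?S = "sphere (0 :: real^'n) 1"
  have ne: "?S \<noteq> {}" by simp
  have cont: "continuous_on ?S (\<lambda>z. z \<bullet> (M *v z))"
    by (intro continuous_intros linear_continuous_on matrix_vector_mul_bounded_linear)
  obtain w where w: "w \<in> ?S" "\<And>z. z \<in> ?S \<Longrightarrow> w \<bullet> (M *v w) \<le> z \<bullet> (M *v z)"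
    using continuous_attains_inf[OF compact_sphere ne cont] by blast
  have "w \<noteq> 0" using w(1) by auto
  then have "w \<bullet> (M *v w) > 0"
    using assms by (simp add: pos_def_def)
  moreover have "z \<bullet> (M *v z) \<ge> (w \<bullet> (M *v w)) * (z \<bullet> z)" for z
  proof (cases "z = 0")
    case False
    define c where "c = norm z"
    have c: "c > 0" using False by (simp add: c_def)
    have "w \<bullet> (M *v w) \<le> (z /\<^sub>R c) \<bullet> (M *v (z /\<^sub>R c))"
      using c by (intro w(2)) (simp add: c_def)
    also have "\<dots> = (z \<bullet> (M *v z)) / c\<^sup>2"
      by (simp add: matrix_vector_mult_scaleR power2_eq_square divide_inverse)
    finally show ?thesis
      using c by (simp add: pos_le_divide_eq c_def power2_norm_eq_inner)
  qed simp
  ultimately show ?thesis by (rule that)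
qed

section \<open>Bounds and limits of quadratic forms\<close>

lemma norm_matrix_vector_le: "norm (M *v x) \<le> norm M * norm x" for M :: "real^'n^'m"
proof -
  have "norm (M *v x) \<le> L2_set (\<lambda>i. norm (M $ i) * norm x) UNIV"
    unfolding norm_vec_def[of "M *v x"]
    by (intro L2_set_mono) (simp_all add: matrix_vector_mul_component Cauchy_Schwarz_ineq2)
  also have "\<dots> = norm M * norm x"
    by (simp add: norm_vec_def[of M] L2_set_left_distrib)
  finally show ?thesis .
qed

lemma abs_quadratic_form_le: "\<bar>x \<bullet> (M *v x)\<bar> \<le> norm M * (x \<bullet> x)" for M :: "real^'n^'n"
proof -
  have "\<bar>x \<bullet> (M *v x)\<bar> \<le> norm x * (norm M * norm x)"
    using Cauchy_Schwarz_ineq2[of x "M *v x"] norm_matrix_vector_le[of M x]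
    by (meson mult_left_mono norm_ge_zero order_trans)
  then show ?thesis by (simp add: dot_square_norm power2_eq_square mult_ac)
qed

text \<open>Polarization at basis vectors: finitely many values of the form control all entries,
  which turns pointwise convergence or boundedness of forms into the same for matrices.\<close>

lemma symmetric_matrix_entry:
  assumes "symmetric_matrix M"
  shows "M $ i $ j = ((axis i 1 + axis j 1) \<bullet> (M *v (axis i 1 + axis j 1))
    - axis i 1 \<bullet> (M *v axis i 1) - axis j 1 \<bullet> (M *v axis j 1)) / 2"
proof -
  have "M $ i $ j = axis i 1 \<bullet> (M *v axis j 1)"
    by (simp add: inner_axis' matrix_vector_mult_basis column_def)
  moreover have "axis j 1 \<bullet> (M *v axis i 1) = axis i 1 \<bullet> (M *v axis j 1)"
    by (metis assms inner_commute symmetric_matrix_inner)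
  ultimately show ?thesis
    by (simp add: quadratic_form_simps)
qed

lemma symmetric_matrices_convergent:
  fixes Ms :: "nat \<Rightarrow> real^'n^'n"
  assumes "\<And>n. symmetric_matrix (Ms n)" "\<And>x. convergent (\<lambda>n. x \<bullet> (Ms n *v x))"
  obtains M where "symmetric_matrix M" "Ms \<longlonglongrightarrow> M"
proof -
  let ?l = "\<lambda>x. lim (\<lambda>n. x \<bullet> (Ms n *v x))"
  define M :: "real^'n^'n" where
    "M = (\<chi> i j. (?l (axis i 1 + axis j 1) - ?l (axis i 1) - ?l (axis j 1)) / 2)"
  have "symmetric_matrix M"
    by (simp add: M_def symmetric_matrix_def transpose_def vec_eq_iff add.commute)
  moreover have "Ms \<longlonglongrightarrow> M"
  proof (intro vec_tendstoI)
    fix i j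
    have l: "(\<lambda>n. x \<bullet> (Ms n *v x)) \<longlonglongrightarrow> ?l x" for x
      using assms(2) by (simp add: convergent_LIMSEQ_iff)
    show "(\<lambda>n. Ms n $ i $ j) \<longlonglongrightarrow> M $ i $ j"
      unfolding symmetric_matrix_entry[OF assms(1)] M_def vec_lambda_beta
      by (intro tendsto_intros l) simp
  qed
  ultimately show ?thesis by (rule that)
qed

lemma tendsto_quadratic_form:
  fixes Ms :: "nat \<Rightarrow> real^'n^'n"
  assumes "Ms \<longlonglongrightarrow> M"
  shows "(\<lambda>n. x \<bullet> (Ms n *v x)) \<longlonglongrightarrow> x \<bullet> (M *v x)"
  unfolding inner_vec_def matrix_vector_mult_def vec_lambda_beta inner_real_def
  by (intro tendsto_intros tendsto_vec_nth assms)

text \<open>A uniform boundedness principle: the pointwise bounds at basis vectors and their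
  pairwise sums bound every entry, hence the norms.\<close>

lemma symmetric_matrices_uniform_bound:
  fixes Ms :: "nat \<Rightarrow> real^'n^'n"
  assumes "\<And>n. symmetric_matrix (Ms n)" "\<And>x. \<exists>c. \<forall>n. \<bar>x \<bullet> (Ms n *v x)\<bar> \<le> c"
  obtains c where "c > 0" "\<And>n x. \<bar>x \<bullet> (Ms n *v x)\<bar> \<le> c * (x \<bullet> x)"
proof -
  obtain b where b: "\<And>x n. \<bar>x \<bullet> (Ms n *v x)\<bar> \<le> b x"
    using assms(2) by metis
  define d where "d = (\<lambda>i j. b (axis i 1 + axis j 1) + b (axis i 1) + b (axis j 1))"
  define c where "c = (\<Sum>i\<in>UNIV. \<Sum>j\<in>UNIV. d i j)"
  have aux: "\<bar>(p - q - r) / 2\<bar> \<le> p' + q' + r'"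
    if "\<bar>p\<bar> \<le> p'" "\<bar>q\<bar> \<le> q'" "\<bar>r\<bar> \<le> r'" for p q r p' q' r' :: real
    using that by (auto simp: abs_le_iff)
  have "\<bar>Ms n $ i $ j\<bar> \<le> d i j" for n i j
    unfolding symmetric_matrix_entry[OF assms(1), of n i j] d_def by (intro aux b)
  then have "(\<Sum>i\<in>UNIV. \<Sum>j\<in>UNIV. \<bar>Ms n $ i $ j\<bar>) \<le> c" for n
    unfolding c_def by (intro sum_mono)
  moreover have "norm (Ms n) \<le> (\<Sum>i\<in>UNIV. \<Sum>j\<in>UNIV. \<bar>Ms n $ i $ j\<bar>)" for n
    unfolding norm_vec_def[of "Ms n"]
    by (intro order.trans[OF L2_set_le_sum] sum_mono norm_le_l1_cart) simp
  ultimately have c: "norm (Ms n) \<le> c" for n by (meson order.trans)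
  have "\<bar>x \<bullet> (Ms n *v x)\<bar> \<le> (\<bar>c\<bar> + 1) * (x \<bullet> x)" for n x
  proof -
    have "norm (Ms n) * (x \<bullet> x) \<le> (\<bar>c\<bar> + 1) * (x \<bullet> x)"
      using c[of n] by (intro mult_right_mono) auto
    then show ?thesis using abs_quadratic_form_le[of x "Ms n"] by linarith
  qed
  then show ?thesis using that[of "\<bar>c\<bar> + 1"] by auto
qed

section \<open>Controllability\<close>

lemma trajectory_append:
  "trajectory A B x u n = z \<Longrightarrow> \<exists>u'. trajectory A B x u' (Suc n) = A *v z + B *v w"
proof (intro exI)
  let ?u = "\<lambda>k. if k < n then u k else w"
  have "trajectory A B x ?u k = trajectory A B x u k" if "k \<le> n" for k
    using that by (induction k) simp_all
  then show "trajectory A B x u n = z \<Longrightarrow> trajectory A B x ?u (Suc n) = A *v z + B *v w" by simp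
qed

lemma trajectory_add: "trajectory A B (x + y) (\<lambda>k. u k + v k) n = trajectory A B x u n + trajectory A B y v n"
  by (induction n) (simp_all add: matrix_vector_right_distrib)

lemma trajectory_scaleR: "trajectory A B (c *\<^sub>R x) (\<lambda>k. c *\<^sub>R u k) n = c *\<^sub>R trajectory A B x u n"
  by (induction n) (simp_all add: scaleR_right_distrib matrix_vector_mult_scaleR)

lemma trajectory_0_0: "trajectory A B 0 (\<lambda>_. 0) n = 0"
  by (induction n) simp_all

lemma trajectory_shift:
  "trajectory A B x u (Suc n) = trajectory A B (A *v x + B *v u 0) (\<lambda>k. u (Suc k)) n"
  by (induction n) simp_all

lemma subspace_reachable: "subspace {y. \<exists>u. trajectory A B 0 u n = y}"
proof (rule subspaceI)
  show "0 \<in> {y. \<exists>u. trajectory A B 0 u n = y}"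
    using trajectory_0_0 by blast
next
  fix y z assume "y \<in> {y. \<exists>u. trajectory A B 0 u n = y}" "z \<in> {y. \<exists>u. trajectory A B 0 u n = y}"
  then show "y + z \<in> {y. \<exists>u. trajectory A B 0 u n = y}"
    using trajectory_add[of A B 0 0 _ _ n] by (auto intro: exI[of _ "\<lambda>k. _ k + _ k"])
next
  fix c :: real and y assume "y \<in> {y. \<exists>u. trajectory A B 0 u n = y}"
  then show "c *\<^sub>R y \<in> {y. \<exists>u. trajectory A B 0 u n = y}"
    using trajectory_scaleR[of A B c 0 _ n] by auto
qed

text \<open>A single impulse \<open>w\<close> at time \<open>n - 1 - k\<close> is carried on by
  \<open>A\<close> for the remaining \<open>k\<close> steps.\<close>

lemma reachable_column:
  "k < n \<Longrightarrow> \<exists>u. trajectory A B 0 u n = mat_power A k *v (B *v w)"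
proof (induction n arbitrary: k)
  case (Suc n)
  show ?case
  proof (cases k)
    case 0
    then show ?thesis
      using trajectory_append[OF trajectory_0_0[of A B n], of w] by (simp add: mat_power_def)
  next
    case (Suc k')
    then obtain u where "trajectory A B 0 u n = mat_power A k' *v (B *v w)"
      using Suc.IH[of k'] Suc.prems by auto
    from trajectory_append[OF this, of 0] show ?thesis
      by (simp add: Suc mat_power_def matrix_vector_mul_assoc matrix_mul_assoc)
  qed
qed simp

text \<open>The reachable states form a subspace containing all columns of the Kalman matrix, whose
  span is the whole space.\<close>

lemma controllable_reachable:
  fixes A :: "real^'x^'x" and B :: "real^'u^'x"
  assumes "controllable A B"
  obtains u where "trajectory A B 0 u CARD('x) = y"
proof -
  let ?V = "{y. \<exists>u. trajectory A B 0 u CARD('x) = y}"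
  have "columns (mat_power A k ** B) \<subseteq> ?V" if k: "k < CARD('x)" for k
  proof
    fix y assume "y \<in> columns (mat_power A k ** B)"
    then obtain i where "y = (mat_power A k ** B) *v axis i 1"
      by (auto simp: columns_def matrix_vector_mult_basis)
    then have "y = mat_power A k *v (B *v axis i 1)" by (simp add: matrix_vector_mul_assoc)
    then show "y \<in> ?V" using reachable_column[OF k] by auto
  qed
  then have "span (\<Union>k<CARD('x). columns (mat_power A k ** B)) \<subseteq> ?V"
    by (intro span_minimal subspace_reachable) auto
  moreover have "span (\<Union>k<CARD('x). columns (mat_power A k ** B)) = UNIV"
    using assms unfolding controllable_def by (intro dim_eq_full[THEN iffD1]) simp
  ultimately show ?thesis using that by blast
qed

text \<open>By superposition it suffices to reach, from the origin, the negative of the free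
  response of \<open>x\<close>.\<close>

lemma controllable_null:
  fixes A :: "real^'x^'x" and B :: "real^'u^'x"
  assumes "controllable A B"
  obtains u where "trajectory A B x u CARD('x) = 0"
proof -
  obtain u where "trajectory A B 0 u CARD('x) = - trajectory A B x (\<lambda>_. 0) CARD('x)"
    by (rule controllable_reachable[OF assms])
  then have "trajectory A B x u CARD('x) = 0"
    using trajectory_add[of A B x 0 "\<lambda>_. 0" u "CARD('x)"] by simp
  then show ?thesis by (rule that)
qed

text \<open>The vector \<open>w\<close> is itself reachable, so its last step writes it as
  \<open>A z + B v\<close>, which is orthogonal to \<open>w\<close>.\<close>

lemma controllable_left_kernel:
  fixes A :: "real^'x^'x" and B :: "real^'u^'x"
  assumes "controllable A B" "w v* A = 0" "w v* B = 0"
  shows "w = 0"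
proof -
  obtain u where u: "trajectory A B 0 u CARD('x) = w"
    by (rule controllable_reachable[OF assms(1)])
  obtain n where "CARD('x) = Suc n"
    using gr0_conv_Suc zero_less_card_finite by blast
  then have "w = A *v trajectory A B 0 u n + B *v u n" using u by simp
  then have "w \<bullet> w = w \<bullet> (A *v trajectory A B 0 u n) + w \<bullet> (B *v u n)"
    by (metis inner_add_right)
  also have "\<dots> = 0" by (simp only: dot_lmul_matrix[symmetric] assms) simp
  finally show ?thesis by simp
qed

text \<open>A left null vector \<open>w\<close> of \<open>A - B K\<close> is not annihilated by \<open>B\<close>, so a rank one change of \<open>K\<close>
  adds a direction transversal to the range and the kernel shrinks.\<close>

lemma controllable_prestabilizable:
  fixes A :: "real^'x^'x" and B :: "real^'u^'x"
  assumes "controllable A B"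
  obtains K where "invertible (A - B ** K)"
proof -
  define ker :: "real^'x^'u \<Rightarrow> (real^'x) set" where "ker K = {x. (A - B ** K) *v x = 0}" for K
  have sub: "subspace (ker K)" for K :: "real^'x^'u"
    unfolding ker_def by (simp add: subspace_def algebra_simps)
  have "\<exists>K'. invertible (A - B ** K')" for K :: "real^'x^'u"
  proof (induction "dim (ker K)" arbitrary: K rule: less_induct)
    case less
    let ?A = "A - B ** K"
    show ?case
    proof (cases "invertible ?A")
      case False
      then obtain v where v: "v \<noteq> 0" "?A *v v = 0"
        by (auto simp: invertible_left_inverse matrix_left_invertible_ker)
      have "\<not> invertible (transpose ?A)"
        using False by (metis transpose_invertible transpose_transpose)
      then obtain w where w: "w \<noteq> 0" "w v* ?A = 0"
        by (auto simp: invertible_left_inverse matrix_left_invertible_ker)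
      define k where "k = w v* B"
      have "k \<noteq> 0"
      proof
        assume "k = 0"
        have "w \<bullet> (A *v x) = w \<bullet> (?A *v x) + k \<bullet> (K *v x)" for x
          by (simp add: k_def quadratic_form_simps inner_commute)
        also have "\<dots> x = 0" for x
          using w(2) \<open>k = 0\<close> by (metis add_0 dot_lmul_matrix inner_zero_left)
        finally have "(w v* A) \<bullet> x = 0" for x by (simp only: dot_lmul_matrix)
        then have "w v* A = 0" by (metis inner_eq_zero_iff)
        then show False
          using controllable_left_kernel[OF assms] \<open>k = 0\<close> w(1) by (simp add: k_def)
      qed
      \<comment> \<open>The added matrix is the outer product of \<open>k\<close> and
        \<open>v\<close>. Since \<open>w\<close> annihilates the range of \<open>?A\<close> but not
        \<open>B k\<close>, pairing with \<open>w\<close> forces the two terms of \<open>K'\<close>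
        to vanish separately on \<open>ker K'\<close>.\<close>
      define K' where "K' = K + (\<chi> i j. k $ i * v $ j)"
      have K': "(A - B ** K') *v x = ?A *v x - (v \<bullet> x) *\<^sub>R (B *v k)" for x
      proof -
        have "(\<chi> i j. k $ i * v $ j) *v x = (v \<bullet> x) *\<^sub>R k"
          by (simp add: vec_eq_iff matrix_vector_mult_def inner_vec_def sum_distrib_left sum_distrib_right mult_ac)
        then show ?thesis
          by (simp add: K'_def quadratic_form_simps matrix_add_ldistrib matrix_vector_mult_scaleR)
      qed
      have wb: "w \<bullet> (B *v k) = k \<bullet> k"
        by (simp add: k_def inner_vector_matrix inner_commute)
      have kerK': "v \<bullet> x = 0 \<and> ?A *v x = 0" if "x \<in> ker K'" for x
      proof -
        have e: "?A *v x = (v \<bullet> x) *\<^sub>R (B *v k)"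
          using that by (simp add: ker_def K')
        have "w \<bullet> (?A *v x) = 0" using w(2) by (metis dot_lmul_matrix inner_zero_left)
        then have "(v \<bullet> x) * (k \<bullet> k) = 0" unfolding e by (simp add: wb)
        then have "v \<bullet> x = 0" using \<open>k \<noteq> 0\<close> by simp
        then show ?thesis using e by simp
      qed
      have "ker K' \<subseteq> ker K"
        using kerK' by (auto simp: ker_def)
      moreover have "v \<notin> ker K'"
        using kerK'[of v] v(1) by auto
      moreover have "v \<in> ker K" using v(2) by (simp add: ker_def)
      ultimately have "dim (ker K') < dim (ker K)"
        using subspace_dim_equal[OF sub[of K'] sub[of K]] by (metis not_le)
      then show ?thesis by (rule less)
    qed blast
  qed
  then show ?thesis using that by blast
qed

section \<open>Schur stability\<close>

lemma affine_recursion_tendsto_0: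
  fixes a b :: "nat \<Rightarrow> complex"
  assumes "cmod l < 1" "b \<longlonglongrightarrow> 0" "\<And>k. a (Suc k) = l * a k + b k"
  shows "a \<longlonglongrightarrow> 0"
proof (rule LIMSEQ_I)
  fix e :: real assume "e > 0"
  define r where "r = cmod l"
  have r: "0 \<le> r" "r < 1" using assms(1) by (auto simp: r_def)
  \<comment> \<open>Forcing below this level preserves the offset \<open>e / 2\<close>, as
    \<open>r * (e / 2) + e / 2 * (1 - r) = e / 2\<close>; only the geometric term remains to be made
    small.\<close>
  have "e / 2 * (1 - r) > 0" using \<open>e > 0\<close> r by simp
  then obtain K where K: "\<And>k. k \<ge> K \<Longrightarrow> cmod (b k) < e / 2 * (1 - r)"
    using LIMSEQ_D[OF assms(2)] by (metis diff_zero)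
  have bound: "cmod (a (K + m)) \<le> r ^ m * cmod (a K) + e / 2" for m
  proof (induction m)
    case 0
    then show ?case using \<open>e > 0\<close> by simp
  next
    case (Suc m)
    have "cmod (a (K + Suc m)) \<le> r * cmod (a (K + m)) + cmod (b (K + m))"
      using norm_triangle_ineq[of "l * a (K + m)" "b (K + m)"] by (simp add: assms(3) norm_mult r_def)
    also have "\<dots> \<le> r * (r ^ m * cmod (a K) + e / 2) + e / 2 * (1 - r)"
      using Suc K[of "K + m"] r by (intro add_mono mult_left_mono) auto
    also have "\<dots> = r ^ Suc m * cmod (a K) + e / 2"
      by (simp add: field_simps)
    finally show ?case .
  qed
  have "(\<lambda>m. r ^ m * cmod (a K)) \<longlonglongrightarrow> 0"
    using r by (intro tendsto_mult_left_zero LIMSEQ_power_zero) auto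
  then obtain M where M: "\<And>m. m \<ge> M \<Longrightarrow> \<bar>r ^ m * cmod (a K)\<bar> < e / 2"
    using LIMSEQ_D[of _ 0 "e / 2"] \<open>e > 0\<close> by (metis diff_zero half_gt_zero real_norm_def)
  have "cmod (a k) < e" if "k \<ge> K + M" for k
  proof -
    have "M \<le> k - K" "K + (k - K) = k" using that by auto
    then show ?thesis
      using bound[of "k - K"] M[of "k - K"] abs_ge_self[of "r ^ (k - K) * cmod (a K)"] by simp
  qed
  then show "\<exists>N. \<forall>k\<ge>N. norm (a k - 0) < e" by auto
qed

section \<open>Polynomials in a matrix acting on a vector, evaluated by Horner's rule\<close>

definition poly_apply :: "complex^'n^'n \<Rightarrow> complex poly \<Rightarrow> complex^'n \<Rightarrow> complex^'n" where
  "poly_apply F p v = fold_coeffs (\<lambda>a w. a *s v + F *v w) p 0"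

lemma poly_apply_0 [simp]: "poly_apply F 0 v = 0"
  by (simp add: poly_apply_def)

lemma poly_apply_pCons [simp]: "poly_apply F (pCons a p) v = a *s v + F *v poly_apply F p v"
  by (cases "p = 0"; cases "a = 0") (simp_all add: poly_apply_def)

lemma poly_apply_add: "poly_apply F (p + q) v = poly_apply F p v + poly_apply F q v"
  by (induction p q rule: poly_induct2)
    (simp_all add: matrix_vector_right_distrib vector_sadd_rdistrib)

lemma poly_apply_smult: "poly_apply F (smult c p) v = c *s poly_apply F p v"
  by (induction p) (simp_all add: vec.scale_right_distrib vector_smult_assoc vec.scale)

lemma poly_apply_sum: "poly_apply F (sum f I) v = (\<Sum>i\<in>I. poly_apply F (f i) v)"
  by (induction I rule: infinite_finite_induct) (simp_all add: poly_apply_add)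

lemma poly_apply_monom: "poly_apply F (monom c i) v = c *s (((*v) F ^^ i) v)"
  by (induction i) (simp_all add: monom_0 monom_Suc vec.scale)

lemma poly_apply_commute: "poly_apply F p (F *v v) = F *v poly_apply F p v"
  by (induction p) (simp_all add: matrix_vector_right_distrib vec.scale)

lemma poly_apply_linear_factor:
  "poly_apply F ([:- l, 1:] * q) v = F *v poly_apply F q v - l *s poly_apply F q v"
proof -
  have "[:- l, 1:] * q = smult (- l) q + pCons 0 q" by simp
  then show ?thesis
    by (simp only: poly_apply_add poly_apply_smult poly_apply_pCons) simp
qed

text \<open>With \<open>poly_apply_linear_factor\<close> this shows that \<open>q\<close>
  annihilates \<open>F v - l v\<close> whenever \<open>[:- l, 1:] * q\<close> annihilates
  \<open>v\<close>.\<close>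

lemma poly_apply_diff_scale:
  "poly_apply F q (F *v v - l *s v) = F *v poly_apply F q v - l *s poly_apply F q v"
proof -
  have "poly_apply F q (w - l *s v) = poly_apply F q w - l *s poly_apply F q v" for w
    by (induction q)
      (simp_all add: matrix_vector_mult_diff_distrib vec.scale mult.commute
        vec.scale_right_diff_distrib vec.scale_right_distrib vector_smult_assoc)
  then show ?thesis by (simp add: poly_apply_commute)
qed

text \<open>Either the orbit of \<open>v\<close> repeats, or finite dimension makes its first
  members linearly dependent. The case split provides the injectivity needed to index the dependence
  by exponents.\<close>

lemma annihilating_poly:
  fixes F :: "complex^'n^'n"
  obtains p where "p \<noteq> 0" "poly_apply F p v = 0"
proof (cases "inj (\<lambda>i. ((*v) F ^^ i) v)")
  case False
  then obtain i j where ij: "i \<noteq> j" "((*v) F ^^ i) v = ((*v) F ^^ j) v"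
    by (auto simp: inj_def)
  let ?p = "monom 1 i + monom (-1) j :: complex poly"
  have "coeff ?p i \<noteq> 0" using ij(1) by simp
  then have "?p \<noteq> 0" by (metis coeff_0)
  moreover have "poly_apply F ?p v = 0"
    using ij(2) by (simp add: poly_apply_add poly_apply_monom)
  ultimately show ?thesis by (rule that)
next
  case True
  let ?g = "\<lambda>i. ((*v) F ^^ i) v"
  \<comment> \<open>One more exponent than the real dimension; the dependence is over the reals, so
    its coefficients are embedded into the complex numbers.\<close>
  define I where "I = {..DIM(complex^'n)}"
  have inj: "inj_on ?g I" using True by (rule inj_on_subset) simp
  have "dependent (?g ` I)"
    using card_image[OF inj] unfolding I_def by (intro dependent_biggerset) simp
  then obtain c where c: "\<exists>w\<in>?g ` I. c w \<noteq> 0" "(\<Sum>w\<in>?g ` I. c w *\<^sub>R w) = 0"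
    by (auto simp: I_def dependent_finite)
  let ?p = "\<Sum>i\<in>I. monom (complex_of_real (c (?g i))) i"
  obtain i where i: "i \<in> I" "c (?g i) \<noteq> 0" using c(1) by blast
  have "coeff ?p i = c (?g i)"
    using i(1) by (simp add: I_def coeff_sum if_distrib sum.delta cong: if_cong)
  then have "?p \<noteq> 0" using i(2) by (metis coeff_0 of_real_eq_0_iff)
  moreover have "poly_apply F ?p v = (\<Sum>i\<in>I. c (?g i) *\<^sub>R ?g i)"
    by (simp add: poly_apply_sum poly_apply_monom vec_eq_iff
        scaleR_conv_of_real[where 'a = complex])
  then have "poly_apply F ?p v = 0"
    using c(2) by (simp add: sum.reindex[OF inj])
  ultimately show ?thesis by (rule that)
qed

text \<open>The linear factors of an annihilating polynomial are stripped off one at a time; a root that is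
  not an eigenvalue can be dropped because its factor acts injectively.\<close>

lemma matrix_powers_tendsto_0:
  fixes F :: "complex^'n^'n"
  assumes eig: "\<And>z v. v \<noteq> 0 \<Longrightarrow> F *v v = z *s v \<Longrightarrow> cmod z < 1"
  shows "(\<lambda>k. ((*v) F ^^ k) v) \<longlonglongrightarrow> 0"
proof -
  have *: "(\<lambda>k. ((*v) F ^^ k) v) \<longlonglongrightarrow> 0" if "p \<noteq> 0" "poly_apply F p v = 0" for p v
    using that
  proof (induction "degree p" arbitrary: p v)
    case 0
    then obtain a where "p = [:a:]" "a \<noteq> 0" by (metis degree_eq_zeroE pCons_0_0)
    then have "v = 0" using 0 by simp
    have "((*v) F ^^ k) 0 = 0" for k by (induction k) simp_all
    then show ?case by (simp add: \<open>v = 0\<close>)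
  next
    case (Suc d)
    then have "\<not> constant (poly p)" by (metis constant_degree nat.distinct(1))
    then obtain l where "poly p l = 0" using fundamental_theorem_of_algebra by blast
    then obtain q where q: "p = [:- l, 1:] * q" by (metis dvdE poly_eq_0_iff_dvd)
    have "q \<noteq> 0" using Suc.prems q by auto
    then have d: "d = degree q"
      using Suc.hyps(2) q by (simp add: degree_mult_eq del: mult_pCons_left)
    let ?w = "poly_apply F q v"
    have w: "F *v ?w = l *s ?w"
      using Suc.prems(2) q by (simp add: poly_apply_linear_factor del: mult_pCons_left)
    show ?case
    proof (cases "?w = 0")
      case True
      then show ?thesis using Suc.hyps(1)[OF d \<open>q \<noteq> 0\<close>] by blast
    next
      case False
      then have "cmod l < 1" using eig w by blast
      \<comment> \<open>Here \<open>?w\<close> is an eigenvector, so \<open>cmod l < 1\<close>. The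
        orbit of \<open>?b\<close> vanishes by induction, and it is the forcing term of a scalar
        recursion with factor \<open>l\<close> for each component of the orbit of
        \<open>v\<close>.\<close>
      let ?b = "F *v v - l *s v"
      have "poly_apply F q ?b = 0"
        using w by (simp add: poly_apply_diff_scale)
      then have b: "(\<lambda>k. ((*v) F ^^ k) ?b) \<longlonglongrightarrow> 0"
        using Suc.hyps(1)[OF d \<open>q \<noteq> 0\<close>] by blast
      have step: "((*v) F ^^ Suc k) v = l *s ((*v) F ^^ k) v + ((*v) F ^^ k) ?b" for k
      proof (induction k)
        case (Suc k)
        have "((*v) F ^^ Suc (Suc k)) v = F *v (((*v) F ^^ Suc k) v)" by simp
        also have "\<dots> = F *v (l *s ((*v) F ^^ k) v + ((*v) F ^^ k) ?b)" by (simp only: Suc.IH)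
        finally show ?case by (simp add: matrix_vector_right_distrib vec.scale)
      qed simp
      show ?thesis
      proof (rule vec_tendstoI)
        fix i
        have "(\<lambda>k. (((*v) F ^^ k) ?b) $ i) \<longlonglongrightarrow> 0"
          using tendsto_vec_nth[OF b, of i] by simp
        moreover have "(((*v) F ^^ Suc k) v) $ i = l * (((*v) F ^^ k) v) $ i + (((*v) F ^^ k) ?b) $ i" for k
          by (simp only: step vector_add_component vector_smult_component)
        ultimately show "(\<lambda>k. (((*v) F ^^ k) v) $ i) \<longlonglongrightarrow> 0 $ i"
          using affine_recursion_tendsto_0[OF \<open>cmod l < 1\<close>, of "\<lambda>k. (((*v) F ^^ k) ?b) $ i" "\<lambda>k. (((*v) F ^^ k) v) $ i"]
          by simp
      qed
    qed
  qed
  obtain p where "p \<noteq> 0" "poly_apply F p v = 0" by (rule annihilating_poly)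
  then show ?thesis by (rule *)
qed

lemma schur_stable_powers_tendsto_0:
  fixes F :: "real^'n^'n"
  assumes "schur_stable F"
  shows "(\<lambda>k. ((*v) F ^^ k) y) \<longlonglongrightarrow> 0"
proof -
  let ?C = "\<chi> i j. complex_of_real (F $ i $ j)"
  let ?c = "\<lambda>y :: real^'n. \<chi> i. complex_of_real (y $ i)"
  have "?C *v ?c y = ?c (F *v y)" for y
    by (simp add: vec_eq_iff matrix_vector_mult_def)
  then have pow: "((*v) ?C ^^ k) (?c y) = ?c (((*v) F ^^ k) y)" for k
    by (induction k) simp_all
  have "(\<lambda>k. ((*v) ?C ^^ k) (?c y)) \<longlonglongrightarrow> 0"
    using assms unfolding schur_stable_def by (intro matrix_powers_tendsto_0) blast
  then have *: "(\<lambda>k. ?c (((*v) F ^^ k) y)) \<longlonglongrightarrow> 0" by (simp only: pow)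
  show ?thesis
  proof (rule vec_tendstoI)
    fix i
    show "(\<lambda>k. (((*v) F ^^ k) y) $ i) \<longlonglongrightarrow> 0 $ i"
      using tendsto_vec_nth[OF *, of i] by (simp add: tendsto_of_real_iff[where c = 0, simplified])
  qed
qed

text \<open>For an eigenvector \<open>a + i b\<close> the cross terms of the form at
  \<open>F a\<close> and \<open>F b\<close> cancel in the sum, which is therefore scaled exactly by
  \<open>(cmod z)^2\<close>.\<close>

lemma lyapunov_schur_stable:
  fixes F :: "real^'n^'n"
  assumes pos: "\<And>y. y \<noteq> 0 \<Longrightarrow> 0 < y \<bullet> (M *v y)"
    and dec: "\<And>y. y \<noteq> 0 \<Longrightarrow> (F *v y) \<bullet> (M *v (F *v y)) < y \<bullet> (M *v y)"
  shows "schur_stable F"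
  unfolding schur_stable_def
proof (intro allI impI)
  fix z :: complex and v :: "complex^'n"
  assume v: "v \<noteq> 0" and eig: "(\<chi> i j. complex_of_real (F $ i $ j)) *v v = z *s v"
  define a where "a = (\<chi> i. Re (v $ i))"
  define b where "b = (\<chi> i. Im (v $ i))"
  have eq: "(\<Sum>j\<in>UNIV. complex_of_real (F $ i $ j) * v $ j) = z * v $ i" for i
    using eig by (simp add: vec_eq_iff matrix_vector_mult_def)
  have Fa: "F *v a = Re z *\<^sub>R a - Im z *\<^sub>R b"
    using arg_cong[OF eq, of Re]
    by (simp add: vec_eq_iff matrix_vector_mult_def a_def b_def)
  have Fb: "F *v b = Im z *\<^sub>R a + Re z *\<^sub>R b"
    using arg_cong[OF eq, of Im]
    by (simp add: vec_eq_iff matrix_vector_mult_def a_def b_def add.commute)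
  let ?q = "\<lambda>y. y \<bullet> (M *v y)"
  have ab: "a \<noteq> 0 \<or> b \<noteq> 0"
    using v by (auto simp: a_def b_def vec_eq_iff complex_eq_iff)
  have pos': "0 \<le> ?q y" for y using pos[of y] by (cases "y = 0") auto
  have dec': "?q (F *v y) \<le> ?q y" for y using dec[of y] by (cases "y = 0") auto
  have "?q (F *v a) + ?q (F *v b) < ?q a + ?q b"
    using ab dec dec' by (metis add_le_less_mono add_less_le_mono)
  moreover have "?q (F *v a) + ?q (F *v b) = (cmod z)\<^sup>2 * (?q a + ?q b)"
    unfolding Fa Fb cmod_power2
    by (simp add: quadratic_form_simps matrix_vector_mult_scaleR) (simp add: algebra_simps power2_eq_square)
  moreover have "?q a + ?q b > 0"
    using ab pos pos' by (metis add_nonneg_pos add_pos_nonneg)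
  ultimately have "(cmod z)\<^sup>2 < 1" by (metis mult_less_cancel_right_pos mult_1)
  then show "cmod z < 1" by (metis abs_norm_cancel abs_square_less_1)
qed

section \<open>The reverse Riccati equation\<close>

text \<open>With \<open>F\<close> the inverse of \<open>A\<close> and \<open>G = F B\<close> these
  are the RDARE data: they charge the state \<open>y\<close> minus the stage cost of the step that
  leads to it from its predecessor \<open>F y + G v\<close> under the input
  \<open>- v\<close>.\<close>

lemma quadratic_cost_reversed:
  assumes "symmetric_matrix Q"
  shows "quadratic_cost (- (transpose F ** Q ** F)) (S ** F - transpose G ** Q ** F)
      (- R + S ** G + transpose G ** transpose S - transpose G ** Q ** G) y v =
    - quadratic_cost Q S R (F *v y + G *v v) (- v)"
proof -
  have "(F *v y) \<bullet> (Q *v (G *v v)) = (G *v v) \<bullet> (Q *v (F *v y))"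
    by (metis assms inner_commute symmetric_matrix_inner)
  then show ?thesis
    by (simp add: quadratic_cost_def quadratic_form_simps inner_commute)
qed

lemma quadratic_cost_prestabilized:
  assumes "symmetric_matrix R"
  shows "quadratic_cost (Q - transpose S ** K - transpose K ** S + transpose K ** R ** K) (S - R ** K) R x w =
    quadratic_cost Q S R x (w - K *v x)"
proof -
  have "(K *v x) \<bullet> (R *v w) = w \<bullet> (R *v (K *v x))"
    by (metis assms inner_commute symmetric_matrix_inner)
  then show ?thesis
    by (simp add: quadratic_cost_def quadratic_form_simps inner_commute)
qed

lemma symmetric_prestabilized:
  assumes "symmetric_matrix Q" "symmetric_matrix R"
  shows "symmetric_matrix (Q - transpose S ** K - transpose K ** S + transpose K ** R ** K)"
  using assms
  by (simp add: symmetric_matrix_def transpose_simps matrix_mul_assoc)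

text \<open>The certificate appears as \<open>L\<close> together with a coercivity constant
  \<open>e\<close>, which replaces positive definiteness of the rotated matrix.\<close>

locale dissipative_lq =
  fixes A Q :: "real^'x^'x" and B :: "real^'u^'x" and S :: "real^'x^'u" and R :: "real^'u^'u"
    and L :: "real^'x^'x" and e :: real
  assumes symQ: "symmetric_matrix Q" and symR: "symmetric_matrix R" and symL: "symmetric_matrix L"
    and e_pos: "e > 0"
    and rotated_bound: "e * (x \<bullet> x + u \<bullet> u) \<le>
      quadratic_cost Q S R x u + x \<bullet> (L *v x) - (A *v x + B *v u) \<bullet> (L *v (A *v x + B *v u))"
begin

definition rotated :: "real^'x \<Rightarrow> real^'u \<Rightarrow> real" where
  "rotated x u = quadratic_cost Q S R x u + x \<bullet> (L *v x)
     - (A *v x + B *v u) \<bullet> (L *v (A *v x + B *v u))"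

lemma rotated_ge: "e * (x \<bullet> x + u \<bullet> u) \<le> rotated x u"
  using rotated_bound by (simp add: rotated_def)

lemma rotated_ge_x: "e * (x \<bullet> x) \<le> rotated x u"
  using rotated_ge[of x u] e_pos by (simp add: distrib_left)
    (meson inner_ge_zero less_imp_le mult_nonneg_nonneg order_trans le_add_same_cancel1)

lemma rotated_nonneg: "0 \<le> rotated x u"
  using rotated_ge[of x u] e_pos
  by (meson add_nonneg_nonneg inner_ge_zero less_imp_le mult_nonneg_nonneg order_trans)

lemma rotated_pos:
  assumes "x \<noteq> 0 \<or> u \<noteq> 0"
  shows "0 < rotated x u"
proof -
  have "0 < x \<bullet> x + u \<bullet> u"
    using assms by (metis add_nonneg_pos add_pos_nonneg inner_ge_zero inner_gt_zero_iff)
  then have "0 < e * (x \<bullet> x + u \<bullet> u)" using e_pos by simp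
  then show ?thesis using rotated_ge[of x u] by linarith
qed

text \<open>The data of the RDARE of the system pre-stabilized by \<open>K\<close>; its input \<open>v\<close> at the predecessor state
  \<open>x\<close> stands for the original input \<open>u = - v - K x\<close>.\<close>

definition rev_A :: "real^'x^'u \<Rightarrow> real^'x^'x" where
  "rev_A K = matrix_inv (A - B ** K)"

definition rev_B :: "real^'x^'u \<Rightarrow> real^'u^'x" where
  "rev_B K = rev_A K ** B"

definition pre_Q :: "real^'x^'u \<Rightarrow> real^'x^'x" where
  "pre_Q K = Q - transpose S ** K - transpose K ** S + transpose K ** R ** K"

definition pre_S :: "real^'x^'u \<Rightarrow> real^'x^'u" where
  "pre_S K = S - R ** K"

definition rev_Q :: "real^'x^'u \<Rightarrow> real^'x^'x" where
  "rev_Q K = - (transpose (rev_A K) ** pre_Q K ** rev_A K)"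

definition rev_S :: "real^'x^'u \<Rightarrow> real^'x^'u" where
  "rev_S K = pre_S K ** rev_A K - transpose (rev_B K) ** pre_Q K ** rev_A K"

definition rev_R :: "real^'x^'u \<Rightarrow> real^'u^'u" where
  "rev_R K = - R + pre_S K ** rev_B K + transpose (rev_B K) ** transpose (pre_S K)
     - transpose (rev_B K) ** pre_Q K ** rev_B K"

lemma rdare_prestabilized_iff:
  "rdare_stabilizing_solution_nonsingular (A - B ** K) B
      (Q - transpose S ** K - transpose K ** S + transpose K ** R ** K) (S - R ** K) R P \<longleftrightarrow>
   dare_stabilizing_solution (rev_A K) (rev_B K) (rev_Q K) (rev_S K) (rev_R K) P"
  by (simp add: rdare_stabilizing_solution_nonsingular_def Let_def rev_A_def rev_B_def rev_Q_def
      rev_S_def rev_R_def pre_Q_def pre_S_def)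

text \<open>The choice \<open>K = 0\<close> recovers nonsingular \<open>A\<close>, so both cases
  belong to one family of reversed data indexed by \<open>K\<close>.\<close>

lemma rdare_iff:
  "rdare_stabilizing_solution A B Q S R P \<longleftrightarrow>
     (if invertible A then dare_stabilizing_solution (rev_A 0) (rev_B 0) (rev_Q 0) (rev_S 0) (rev_R 0) P
      else \<exists>K. invertible (A - B ** K) \<and>
        dare_stabilizing_solution (rev_A K) (rev_B K) (rev_Q K) (rev_S K) (rev_R K) P)"
proof -
  have "transpose (0 :: real^'x^'u) = 0" by (simp add: transpose_def vec_eq_iff)
  then show ?thesis
    using rdare_prestabilized_iff[of 0 P]
    by (simp add: rdare_stabilizing_solution_def rdare_prestabilized_iff)
qed

section \<open>Time reversal of costs, steps and completed squares\<close>

lemma symmetric_pre_Q: "symmetric_matrix (pre_Q K)"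
  unfolding pre_Q_def by (intro symmetric_prestabilized symQ symR)

lemma symmetric_rev_Q: "symmetric_matrix (rev_Q K)"
  unfolding rev_Q_def
  by (intro symmetric_matrix_uminus symmetric_matrix_congruence symmetric_pre_Q)

lemma symmetric_rev_R: "symmetric_matrix (rev_R K)"
  using symR symmetric_pre_Q[of K] unfolding rev_R_def symmetric_matrix_def
  by (simp add: transpose_simps matrix_mul_assoc add.commute add.left_commute)

lemma reversed_cost:
  "quadratic_cost (rev_Q K) (rev_S K) (rev_R K) y v =
     - quadratic_cost Q S R (rev_A K *v y + rev_B K *v v)
         (- v - K *v (rev_A K *v y + rev_B K *v v))"
proof -
  have "quadratic_cost (rev_Q K) (rev_S K) (rev_R K) y v =
    - quadratic_cost (pre_Q K) (pre_S K) R (rev_A K *v y + rev_B K *v v) (- v)"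
    unfolding rev_Q_def rev_S_def rev_R_def
    by (rule quadratic_cost_reversed[OF symmetric_pre_Q])
  then show ?thesis
    by (simp only: pre_Q_def pre_S_def quadratic_cost_prestabilized[OF symR])
qed

text \<open>Together with \<open>forward_step\<close> this puts the pairs of state and input in
  bijection with the pairs of successor \<open>y\<close> and reversed input \<open>v\<close>, so
  choosing \<open>v\<close> freely means choosing any step that ends in \<open>y\<close>.\<close>

lemma reversed_step:
  assumes "invertible (A - B ** K)"
  shows "rev_A K *v (A *v x + B *v u) + rev_B K *v (- (u + K *v x)) = x"
proof -
  have "rev_A K *v y + rev_B K *v (- w) = rev_A K *v (y - B *v w)" for y w
    by (simp add: rev_B_def quadratic_form_simps)
  moreover have "A *v x + B *v u - B *v (u + K *v x) = (A - B ** K) *v x"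
    by (simp add: quadratic_form_simps)
  ultimately show ?thesis
    using matrix_inv_vector(1)[OF assms, of x] by (simp only: rev_A_def)
qed

lemma forward_step:
  assumes "invertible (A - B ** K)" "x = rev_A K *v y + rev_B K *v v"
  shows "A *v x + B *v (- v - K *v x) = y"
proof -
  have "(A - B ** K) *v x = y + B *v v"
    using matrix_inv_vector(2)[OF assms(1), of "y + B *v v"]
    by (simp add: assms(2) rev_B_def rev_A_def matrix_vector_mul_assoc[symmetric] matrix_vector_right_distrib)
  then show ?thesis by (simp add: quadratic_form_simps algebra_simps)
qed

text \<open>Completion of squares for the reversed data with all signs turned, read for
  \<open>- (P + L)\<close>: once the Hessian is negative definite, the subtracted square is the
  excess over the least cost of arriving at \<open>y\<close>.\<close>

lemma reversed_identity:
  assumes inv: "invertible (A - B ** K)" and P: "symmetric_matrix P"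
    and T: "invertible (rev_R K + transpose (rev_B K) ** P ** rev_B K)"
    and x: "x = rev_A K *v y + rev_B K *v v"
  defines "G \<equiv> riccati_gain (rev_A K) (rev_B K) (rev_S K) (rev_R K) P"
    and "P' \<equiv> riccati_step (rev_A K) (rev_B K) (rev_Q K) (rev_S K) (rev_R K) P"
  shows "rotated x (- v - K *v x) + x \<bullet> (- (P + L) *v x) = y \<bullet> (- (P' + L) *v y)
    - (v + G *v y) \<bullet> ((rev_R K + transpose (rev_B K) ** P ** rev_B K) *v (v + G *v y))"
  using riccati_completion_of_squares[OF symmetric_rev_R P T,
      where A = "rev_A K" and Q = "rev_Q K" and S = "rev_S K" and x = y and u = v]
  unfolding reversed_cost x[symmetric] G_def[symmetric] P'_def[symmetric] rotated_def
    forward_step[OF inv x]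
  by (simp add: quadratic_form_simps)

text \<open>This is the case \<open>y = 0\<close>: the Hessian measures, up to sign, the cost of a
  step into the origin.\<close>

lemma reversed_hessian:
  assumes inv: "invertible (A - B ** K)" and x: "x = rev_B K *v v"
  shows "v \<bullet> ((rev_R K + transpose (rev_B K) ** P ** rev_B K) *v v) =
    - (rotated x (- v - K *v x) + x \<bullet> (- (P + L) *v x))"
proof -
  have x': "x = rev_A K *v 0 + rev_B K *v v" using x by simp
  have "v \<bullet> (rev_R K *v v) = quadratic_cost (rev_Q K) (rev_S K) (rev_R K) 0 v"
    by (simp add: quadratic_cost_def)
  also have "\<dots> = - quadratic_cost Q S R x (- v - K *v x)"
    by (simp only: reversed_cost x'[symmetric])
  finally show ?thesis
    unfolding rotated_def forward_step[OF inv x']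
    by (simp add: quadratic_form_simps x)
qed

definition psd :: "real^'x^'x \<Rightarrow> bool" where
  "psd M \<longleftrightarrow> symmetric_matrix M \<and> (\<forall>x. 0 \<le> x \<bullet> (M *v x))"

text \<open>\<open>M'\<close> is the value function of the one-step problem of reaching a given state, where starting
  at \<open>x\<close> costs \<open>x \<bullet> M x\<close>.\<close>

definition backward_value :: "real^'x^'x \<Rightarrow> real^'x^'x \<Rightarrow> bool" where
  "backward_value M M' \<longleftrightarrow>
     (\<forall>x u. (A *v x + B *v u) \<bullet> (M' *v (A *v x + B *v u)) \<le> rotated x u + x \<bullet> (M *v x)) \<and>
     (\<forall>y. \<exists>x u. A *v x + B *v u = y \<and> y \<bullet> (M' *v y) = rotated x u + x \<bullet> (M *v x))"

lemma backward_value_le: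
  "backward_value M M' \<Longrightarrow> A *v x + B *v u = y \<Longrightarrow> y \<bullet> (M' *v y) \<le> rotated x u + x \<bullet> (M *v x)"
  by (auto simp: backward_value_def)

lemma backward_value_attained:
  assumes "backward_value M M'"
  obtains x u where "A *v x + B *v u = y" "y \<bullet> (M' *v y) = rotated x u + x \<bullet> (M *v x)"
  using assms unfolding backward_value_def by blast

lemma backward_value_mono:
  assumes "backward_value M M'" "backward_value N N'" "\<And>x. x \<bullet> (M *v x) \<le> x \<bullet> (N *v x)"
  shows "y \<bullet> (M' *v y) \<le> y \<bullet> (N' *v y)"
proof -
  obtain x u where xu: "A *v x + B *v u = y" "y \<bullet> (N' *v y) = rotated x u + x \<bullet> (N *v x)"
    using backward_value_attained[OF assms(2)] .
  then show ?thesis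
    using backward_value_le[OF assms(1) xu(1)] assms(3)[of x] by linarith
qed

lemma backward_value_psd:
  assumes "psd M" "symmetric_matrix M'" "backward_value M M'"
  shows "psd M'"
  unfolding psd_def
proof (intro conjI allI)
  fix y
  obtain x u where "y \<bullet> (M' *v y) = rotated x u + x \<bullet> (M *v x)"
    using backward_value_attained[OF assms(3)] .
  then show "0 \<le> y \<bullet> (M' *v y)"
    using rotated_nonneg[of x u] assms(1) by (simp add: psd_def)
qed fact

lemma backward_fixpoint_pos:
  assumes "psd M" "backward_value M M" "y \<noteq> 0"
  shows "0 < y \<bullet> (M *v y)"
proof -
  obtain x u where xu: "A *v x + B *v u = y" "y \<bullet> (M *v y) = rotated x u + x \<bullet> (M *v x)"
    using backward_value_attained[OF assms(2)] .
  then have "x \<noteq> 0 \<or> u \<noteq> 0" using assms(3) by auto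
  then show ?thesis
    using rotated_pos[of x u] assms(1) xu(2) by (simp add: psd_def add_pos_nonneg)
qed

lemma reversed_hessian_neg:
  assumes inv: "invertible (A - B ** K)" and M: "psd M" and "v \<noteq> 0"
  shows "v \<bullet> ((rev_R K + transpose (rev_B K) ** (- (M + L)) ** rev_B K) *v v) < 0"
proof -
  let ?x = "rev_B K *v v"
  \<comment> \<open>If the predecessor is zero, the input is \<open>- v\<close>.\<close>
  have "?x \<noteq> 0 \<or> - v - K *v ?x \<noteq> 0" using \<open>v \<noteq> 0\<close> by auto
  then have "0 < rotated ?x (- v - K *v ?x) + ?x \<bullet> (M *v ?x)"
    using rotated_pos M by (simp add: psd_def add_pos_nonneg)
  then show ?thesis
    unfolding reversed_hessian[OF inv refl] by simp
qed

text \<open>For \<open>psd M\<close> the reversed Hessian is negative definite, so a reverse Riccati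
  step solves the one-step arrival problem; \<open>F y\<close> is the optimal predecessor of
  \<open>y\<close>.\<close>

lemma backward_step:
  assumes inv: "invertible (A - B ** K)" and M: "psd M"
  defines "P \<equiv> - (M + L)"
  defines "M' \<equiv> - (riccati_step (rev_A K) (rev_B K) (rev_Q K) (rev_S K) (rev_R K) P + L)"
    and "G \<equiv> riccati_gain (rev_A K) (rev_B K) (rev_S K) (rev_R K) P"
    and "F \<equiv> rev_A K - rev_B K ** riccati_gain (rev_A K) (rev_B K) (rev_S K) (rev_R K) P"
  shows "symmetric_matrix P" "invertible (rev_R K + transpose (rev_B K) ** P ** rev_B K)"
    "symmetric_matrix M'" "backward_value M M'"
    "y \<bullet> (M' *v y) = rotated (F *v y) (G *v y - K *v (F *v y)) + (F *v y) \<bullet> (M *v (F *v y))"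
    "A *v (F *v y) + B *v (G *v y - K *v (F *v y)) = y"
proof -
  let ?T = "rev_R K + transpose (rev_B K) ** P ** rev_B K"
  have neg: "v \<noteq> 0 \<Longrightarrow> v \<bullet> (?T *v v) < 0" for v
    unfolding P_def by (rule reversed_hessian_neg[OF inv M])
  then have neg': "v \<bullet> (?T *v v) \<le> 0" for v by (cases "v = 0") (auto intro: less_imp_le)
  show T: "invertible ?T"
    by (rule invertible_if_definite) (metis neg less_irrefl)
  show P: "symmetric_matrix P"
    unfolding P_def using M symL by (intro symmetric_matrix_uminus symmetric_matrix_add) (simp_all add: psd_def)
  show "symmetric_matrix M'"
    unfolding M'_def
    by (intro symmetric_matrix_uminus symmetric_matrix_add symmetric_riccati_step symmetric_rev_Q symmetric_rev_R P T symL)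
  have PM: "- (P + L) = M" by (simp add: P_def)
  have id: "rotated x (- v - K *v x) + x \<bullet> (M *v x) = y \<bullet> (M' *v y) - (v + G *v y) \<bullet> (?T *v (v + G *v y))"
    if "x = rev_A K *v y + rev_B K *v v" for x y v
    using reversed_identity[OF inv P T that] unfolding PM M'_def G_def .
  \<comment> \<open>The reversed input \<open>- (G y)\<close> makes the completed square
    vanish.\<close>
  have Fx: "F *v y = rev_A K *v y + rev_B K *v (- (G *v y))" for y
    by (simp add: F_def G_def quadratic_form_simps)
  have eq: "y \<bullet> (M' *v y) = rotated (F *v y) (G *v y - K *v (F *v y)) + (F *v y) \<bullet> (M *v (F *v y))" for y
    using id[OF Fx, of y] by simp
  have dyn: "A *v (F *v y) + B *v (G *v y - K *v (F *v y)) = y" for y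
    using forward_step[OF inv Fx, of y] by simp
  show "y \<bullet> (M' *v y) = rotated (F *v y) (G *v y - K *v (F *v y)) + (F *v y) \<bullet> (M *v (F *v y))"
    by (rule eq)
  show "A *v (F *v y) + B *v (G *v y - K *v (F *v y)) = y"
    by (rule dyn)
  show "backward_value M M'"
    unfolding backward_value_def
  proof (intro conjI allI)
    fix x u
    show "(A *v x + B *v u) \<bullet> (M' *v (A *v x + B *v u)) \<le> rotated x u + x \<bullet> (M *v x)"
      using id[OF reversed_step[OF inv, symmetric], of x u]
        neg'[of "- (u + K *v x) + G *v (A *v x + B *v u)"] by simp
  next
    fix y
    show "\<exists>x u. A *v x + B *v u = y \<and> y \<bullet> (M' *v y) = rotated x u + x \<bullet> (M *v x)"
      using eq dyn by blast
  qed
qed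

section \<open>Stabilizing RDARE solutions as fixed points of the arrival problem\<close>

text \<open>The value of the one-step problem is unique, so the Riccati step reproduces
  \<open>M\<close>; and \<open>M\<close> is a Lyapunov function for the optimal predecessor map,
  along which it drops by the positive rotated cost.\<close>

lemma rdare_solution_of_fixpoint:
  assumes inv: "invertible (A - B ** K)" and M: "psd M" "backward_value M M"
  shows "dare_stabilizing_solution (rev_A K) (rev_B K) (rev_Q K) (rev_S K) (rev_R K) (- (M + L))"
proof -
  let ?P = "- (M + L)"
  let ?P' = "riccati_step (rev_A K) (rev_B K) (rev_Q K) (rev_S K) (rev_R K) ?P"
  note step = backward_step[OF inv M(1)]
  have fixpoint: "- (?P' + L) = M"
  proof (rule symmetric_matrix_eqI[OF step(3)])
    show "symmetric_matrix M" using M(1) by (simp add: psd_def)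
    show "x \<bullet> (- (?P' + L) *v x) = x \<bullet> (M *v x)" for x
      by (intro antisym backward_value_mono[OF step(4) M(2)] backward_value_mono[OF M(2) step(4)]) auto
  qed
  have "- (M + L) = X" if "- (X + L) = M" for X
    using that by (auto simp: algebra_simps)
  from this[OF fixpoint] have P': "?P = ?P'" .
  have "schur_stable (rev_A K - rev_B K ** riccati_gain (rev_A K) (rev_B K) (rev_S K) (rev_R K) ?P)"
    (is "schur_stable ?F")
  proof (rule lyapunov_schur_stable[of M])
    fix y :: "real^'x" assume "y \<noteq> 0"
    then show "0 < y \<bullet> (M *v y)" by (rule backward_fixpoint_pos[OF M])
    let ?u = "riccati_gain (rev_A K) (rev_B K) (rev_S K) (rev_R K) ?P *v y - K *v (?F *v y)"
    have "?F *v y \<noteq> 0 \<or> ?u \<noteq> 0"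
      using step(6)[of y] \<open>y \<noteq> 0\<close> by (metis add_0 matrix_vector_mult_0_right)
    then show "(?F *v y) \<bullet> (M *v (?F *v y)) < y \<bullet> (M *v y)"
      using rotated_pos[of "?F *v y" ?u] step(5)[of y] unfolding fixpoint by simp
  qed
  then show ?thesis
    unfolding dare_stabilizing_solution_def
    by (intro conjI step(1,2) P')
qed

text \<open>No sign of \<open>M\<close> is known at this point, but at the stationary input the
  completed square vanishes and the cost balance is an equality.\<close>

lemma rdare_solution_orbit:
  assumes inv: "invertible (A - B ** K)"
    and P: "dare_stabilizing_solution (rev_A K) (rev_B K) (rev_Q K) (rev_S K) (rev_R K) P"
  defines "M \<equiv> - (P + L)"
  obtains F G where "schur_stable F" "\<And>y. A *v (F *v y) + B *v G y = y"
    "\<And>y. y \<bullet> (M *v y) = rotated (F *v y) (G y) + (F *v y) \<bullet> (M *v (F *v y))"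
proof -
  let ?H = "riccati_gain (rev_A K) (rev_B K) (rev_S K) (rev_R K) P"
  let ?F = "rev_A K - rev_B K ** ?H"
  have P': "symmetric_matrix P" "invertible (rev_R K + transpose (rev_B K) ** P ** rev_B K)"
    "riccati_step (rev_A K) (rev_B K) (rev_Q K) (rev_S K) (rev_R K) P = P" "schur_stable ?F"
    using P by (simp_all add: dare_stabilizing_solution_def)
  have Fx: "?F *v y = rev_A K *v y + rev_B K *v (- (?H *v y))" for y
    by (simp add: quadratic_form_simps)
  show ?thesis
  proof (rule that[of ?F "\<lambda>y. ?H *v y - K *v (?F *v y)"])
    show "A *v (?F *v y) + B *v (?H *v y - K *v (?F *v y)) = y" for y
      using forward_step[OF inv Fx, of y] by simp
    show "y \<bullet> (M *v y) = rotated (?F *v y) (?H *v y - K *v (?F *v y)) + (?F *v y) \<bullet> (M *v (?F *v y))" for y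
      using reversed_identity[OF inv P'(1,2) Fx, of y] unfolding P'(3) M_def by simp
  qed fact
qed

lemma orbit_limit:
  fixes N :: "real^'x^'x"
  assumes "schur_stable F"
  shows "(\<lambda>k. (((*v) F ^^ k) y) \<bullet> (N *v (((*v) F ^^ k) y))) \<longlonglongrightarrow> 0"
proof -
  have "(\<lambda>k. (((*v) F ^^ k) y) \<bullet> (N *v (((*v) F ^^ k) y))) \<longlonglongrightarrow> 0 \<bullet> (N *v 0)"
    by (intro tendsto_inner schur_stable_powers_tendsto_0[OF assms]
        bounded_linear.tendsto[OF matrix_vector_mul_bounded_linear])
  then show ?thesis by simp
qed

text \<open>Going backwards along the orbit of \<open>F\<close>, the form of \<open>M\<close> loses
  exactly the rotated cost and that of \<open>N\<close> at most as much. Their difference thus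
  decreases to its limit 0 and is nonnegative at the start.\<close>

lemma backward_value_le_orbit:
  assumes F: "schur_stable F" "\<And>y. A *v (F *v y) + B *v G y = y"
    "\<And>y. y \<bullet> (M *v y) = rotated (F *v y) (G y) + (F *v y) \<bullet> (M *v (F *v y))"
    and N: "\<And>x u. (A *v x + B *v u) \<bullet> (N *v (A *v x + B *v u)) \<le> rotated x u + x \<bullet> (N *v x)"
  shows "y \<bullet> (N *v y) \<le> y \<bullet> (M *v y)"
proof -
  let ?y = "\<lambda>k. ((*v) F ^^ k) y"
  let ?d = "\<lambda>k. ?y k \<bullet> (M *v ?y k) - ?y k \<bullet> (N *v ?y k)"
  have "?d (Suc k) \<le> ?d k" for k
    using N[of "F *v ?y k" "G (?y k)"] F(3)[of "?y k"] by (simp add: F(2))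
  then have "decseq ?d" by (simp add: decseq_Suc_iff)
  moreover have "?d \<longlonglongrightarrow> 0 - 0"
    by (intro tendsto_diff orbit_limit F)
  ultimately have "0 \<le> ?d 0"
    using decseq_ge[of ?d 0 0] by simp
  then show ?thesis by simp
qed

text \<open>Nonnegativity comes from comparison with the zero form, which satisfies the growth
  inequality because the rotated cost is nonnegative. Then \<open>backward_step\<close> applies,
  with \<open>M\<close> as its own value.\<close>

lemma rdare_solution_fixpoint:
  assumes inv: "invertible (A - B ** K)"
    and P: "dare_stabilizing_solution (rev_A K) (rev_B K) (rev_Q K) (rev_S K) (rev_R K) P"
  defines "M \<equiv> - (P + L)"
  shows "psd M" "backward_value M M"
proof -
  obtain F G where F: "schur_stable F" "\<And>y. A *v (F *v y) + B *v G y = y"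
    "\<And>y. y \<bullet> (M *v y) = rotated (F *v y) (G y) + (F *v y) \<bullet> (M *v (F *v y))"
    by (rule rdare_solution_orbit[OF inv P, folded M_def]) (rule that)
  have "0 \<le> y \<bullet> (M *v y)" for y
    using backward_value_le_orbit[OF F, of 0] rotated_nonneg by simp
  moreover have "symmetric_matrix M"
    using P symL unfolding M_def dare_stabilizing_solution_def
    by (intro symmetric_matrix_uminus symmetric_matrix_add) blast+
  ultimately show psd: "psd M" by (simp add: psd_def)
  have "- (M + L) = P" by (simp add: M_def)
  moreover have "riccati_step (rev_A K) (rev_B K) (rev_Q K) (rev_S K) (rev_R K) P = P"
    using P by (simp add: dare_stabilizing_solution_def)
  ultimately show "backward_value M M"
    using backward_step(4)[OF inv psd] by (simp add: M_def)
qed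

text \<open>The arrival problem does not involve the pre-stabilizing gain, so solutions for
  different gains can be compared along each other's orbits.\<close>

lemma rdare_solution_unique:
  assumes "invertible (A - B ** K)" "invertible (A - B ** K')"
    and "dare_stabilizing_solution (rev_A K) (rev_B K) (rev_Q K) (rev_S K) (rev_R K) P"
    and "dare_stabilizing_solution (rev_A K') (rev_B K') (rev_Q K') (rev_S K') (rev_R K') P'"
  shows "P = P'"
proof -
  have le: "y \<bullet> (- (P + L) *v y) \<le> y \<bullet> (- (P' + L) *v y)"
    if inv: "invertible (A - B ** K)" "invertible (A - B ** K')"
      and P: "dare_stabilizing_solution (rev_A K) (rev_B K) (rev_Q K) (rev_S K) (rev_R K) P"
      and P': "dare_stabilizing_solution (rev_A K') (rev_B K') (rev_Q K') (rev_S K') (rev_R K') P'"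
    for K K' P P' y
  proof -
    obtain F G where "schur_stable F" "\<And>y. A *v (F *v y) + B *v G y = y"
      "\<And>y. y \<bullet> (- (P' + L) *v y) = rotated (F *v y) (G y) + (F *v y) \<bullet> (- (P' + L) *v (F *v y))"
      by (rule rdare_solution_orbit[OF inv(2) P']) (rule that)
    then show ?thesis
      using rdare_solution_fixpoint(2)[OF inv(1) P] unfolding backward_value_def
      by (intro backward_value_le_orbit) blast+
  qed
  show ?thesis
  proof (rule symmetric_matrix_eqI)
    show "symmetric_matrix P" "symmetric_matrix P'"
      using assms(3,4) by (simp_all add: dare_stabilizing_solution_def)
    show "x \<bullet> (P *v x) = x \<bullet> (P' *v x)" for x
      using le[OF assms, of x] le[OF assms(2,1,4,3), of x] by (simp add: quadratic_form_simps)
  qed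
qed

text \<open>Value iteration from 0, that is with a free initial state, increases; it is bounded by
  the cost of steering the origin to \<open>y\<close>. Coercivity confines the optimal predecessors,
  so the minimum passes to the limit.\<close>

lemma backward_fixpoint_exists:
  assumes ctrl: "controllable A B"
  obtains M where "psd M" "backward_value M M"
proof -
  obtain K where inv: "invertible (A - B ** K)"
    by (rule controllable_prestabilizable[OF ctrl])
  have step: "\<exists>M'. psd M' \<and> backward_value M M'" if "psd M" for M
    using backward_step(3,4)[OF inv that] backward_value_psd[OF that] by blast
  have psd0: "psd 0"
    by (simp add: psd_def symmetric_matrix_def transpose_def vec_eq_iff)
  obtain Ms where "Ms 0 = 0 \<and> (\<forall>n. psd (Ms n)) \<and> (\<forall>n. backward_value (Ms n) (Ms (Suc n)))"
    using dependent_nat_choice[of "\<lambda>n M. psd M \<and> (n = 0 \<longrightarrow> M = 0)" "\<lambda>_. backward_value"]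
      psd0 step by (metis nat.distinct(1))
  then have Ms: "Ms 0 = 0" "\<And>n. psd (Ms n)" "\<And>n. backward_value (Ms n) (Ms (Suc n))" by auto
  have mono1: "y \<bullet> (Ms n *v y) \<le> y \<bullet> (Ms (Suc n) *v y)" for n y
  proof (induction n arbitrary: y)
    case 0
    then show ?case using Ms(2)[of 1] by (simp add: Ms(1) psd_def)
  next
    case (Suc n)
    show ?case by (rule backward_value_mono[OF Ms(3) Ms(3)]) (rule Suc.IH)
  qed
  then have mono: "incseq (\<lambda>n. y \<bullet> (Ms n *v y))" for y
    by (simp add: incseq_Suc_iff)
  \<comment> \<open>Each step of the path raises the iteration index by one; the bound is uniform in
    \<open>m\<close> because the path starts at 0, where every form vanishes.\<close>
  have bound: "\<exists>c. \<forall>m. trajectory A B 0 u k \<bullet> (Ms (m + k) *v trajectory A B 0 u k) \<le> c" for u k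
  proof (induction k)
    case 0
    then show ?case by auto
  next
    case (Suc k)
    then obtain c where c: "\<And>m. trajectory A B 0 u k \<bullet> (Ms (m + k) *v trajectory A B 0 u k) \<le> c" by blast
    have "trajectory A B 0 u (Suc k) \<bullet> (Ms (m + Suc k) *v trajectory A B 0 u (Suc k))
      \<le> rotated (trajectory A B 0 u k) (u k) + c" for m
      using backward_value_le[OF Ms(3)[of "m + k"], of "trajectory A B 0 u k" "u k" "trajectory A B 0 u (Suc k)"] c[of m]
      by simp
    then show ?case by blast
  qed
  have bdd: "\<exists>c. \<forall>n. y \<bullet> (Ms n *v y) \<le> c" for y
  proof -
    obtain u where u: "trajectory A B 0 u CARD('x) = y"
      by (rule controllable_reachable[OF ctrl])
    obtain c where "\<And>m. y \<bullet> (Ms (m + CARD('x)) *v y) \<le> c"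
      using bound[of u "CARD('x)"] u by auto
    then have "y \<bullet> (Ms n *v y) \<le> c" for n
      using incseqD[OF mono[of y], of n "n + CARD('x)"] by (meson le_add1 order_trans)
    then show ?thesis by blast
  qed
  have "convergent (\<lambda>n. y \<bullet> (Ms n *v y))" for y
    using bdd[of y] incseq_convergent[OF mono[of y]] by (metis convergent_def)
  then obtain M where M: "symmetric_matrix M" "Ms \<longlonglongrightarrow> M"
    using symmetric_matrices_convergent[of Ms] Ms(2) unfolding psd_def by blast
  note lim = tendsto_quadratic_form[OF M(2)]
  have Ms_le: "y \<bullet> (Ms n *v y) \<le> y \<bullet> (M *v y)" for y n
    by (rule incseq_le[OF mono lim])
  have psdM: "psd M"
    unfolding psd_def using M(1) Ms_le[of _ 0] by (simp add: Ms(1))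
  obtain M' where M': "psd M'" "backward_value M M'" using step[OF psdM] by blast
  have le: "(A *v x + B *v u) \<bullet> (M *v (A *v x + B *v u)) \<le> rotated x u + x \<bullet> (M *v x)" for x u
    by (rule LIMSEQ_le[OF LIMSEQ_Suc[OF lim] tendsto_add[OF tendsto_const lim]])
      (use backward_value_le[OF Ms(3)] in blast)
  have "M' = M"
  proof (rule symmetric_matrix_eqI[OF _ M(1)])
    show "symmetric_matrix M'" using M'(1) by (simp add: psd_def)
    fix y
    obtain x u where "A *v x + B *v u = y" "y \<bullet> (M' *v y) = rotated x u + x \<bullet> (M *v x)"
      using backward_value_attained[OF M'(2)] .
    then have 1: "y \<bullet> (M *v y) \<le> y \<bullet> (M' *v y)" using le[of x u] by simp
    \<comment> \<open>The predecessor optimal for \<open>Ms n\<close> satisfies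
      \<open>x \<bullet> x \<le> y \<bullet> (M *v y) / e\<close> independently of \<open>n\<close>;
      used as a candidate for \<open>M\<close>, it costs too much by at most the error of the forms
      on this ball.\<close>
    have "y \<bullet> (M' *v y) \<le> y \<bullet> (M *v y) + norm (M - Ms n) * (y \<bullet> (M *v y) / e)" for n
    proof -
      obtain x u where xu: "A *v x + B *v u = y" "y \<bullet> (Ms (Suc n) *v y) = rotated x u + x \<bullet> (Ms n *v x)"
        using backward_value_attained[OF Ms(3)] .
      have "e * (x \<bullet> x) \<le> y \<bullet> (M *v y)"
        using rotated_ge_x[of x u] Ms(2)[of n] Ms_le[of y "Suc n"] xu(2)
        by (simp add: psd_def) (meson add_increasing2 order_trans)
      then have "x \<bullet> x \<le> y \<bullet> (M *v y) / e"
        using e_pos by (simp add: pos_le_divide_eq mult.commute)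
      then have "norm (M - Ms n) * (x \<bullet> x) \<le> norm (M - Ms n) * (y \<bullet> (M *v y) / e)"
        by (intro mult_left_mono) auto
      moreover have "x \<bullet> (M *v x) \<le> x \<bullet> (Ms n *v x) + norm (M - Ms n) * (x \<bullet> x)"
        using abs_quadratic_form_le[of x "M - Ms n"] by (simp add: quadratic_form_simps)
      moreover have "y \<bullet> (M' *v y) \<le> rotated x u + x \<bullet> (M *v x)"
        by (rule backward_value_le[OF M'(2) xu(1)])
      ultimately show ?thesis using xu(2) Ms_le[of y "Suc n"] by linarith
    qed
    moreover have "(\<lambda>n. y \<bullet> (M *v y) + norm (M - Ms n) * (y \<bullet> (M *v y) / e))
      \<longlonglongrightarrow> y \<bullet> (M *v y) + norm (M - M) * (y \<bullet> (M *v y) / e)"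
      by (intro tendsto_intros M(2))
    ultimately have "y \<bullet> (M' *v y) \<le> y \<bullet> (M *v y)"
      using LIMSEQ_le_const[of _ _ "y \<bullet> (M' *v y)"] by fastforce
    with 1 show "y \<bullet> (M' *v y) = y \<bullet> (M *v y)" by simp
  qed
  then show ?thesis using that psdM M'(2) by blast
qed

lemma rdare_solution_exists1:
  assumes ctrl: "controllable A B"
  shows "\<exists>!P. rdare_stabilizing_solution A B Q S R P"
proof -
  obtain M where M: "psd M" "backward_value M M"
    by (rule backward_fixpoint_exists[OF ctrl])
  obtain K where K: "invertible (A - B ** K)"
    by (rule controllable_prestabilizable[OF ctrl])
  show ?thesis
  proof (cases "invertible A")
    case True
    then have inv: "invertible (A - B ** 0)" by simp
    show ?thesis
      using rdare_solution_of_fixpoint[OF inv M] rdare_solution_unique[OF inv inv] True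
      unfolding rdare_iff by auto
  next
    case False
    then show ?thesis
      using rdare_solution_of_fixpoint[OF K M] rdare_solution_unique K
      unfolding rdare_iff by (auto 0 4)
  qed
qed

lemma rdare_stabilizing_solution_fixpoint:
  assumes "rdare_stabilizing_solution A B Q S R P"
  shows "psd (- (P + L))" "backward_value (- (P + L)) (- (P + L))"
proof -
  obtain K where "invertible (A - B ** K)"
    "dare_stabilizing_solution (rev_A K) (rev_B K) (rev_Q K) (rev_S K) (rev_R K) P"
  proof (cases "invertible A")
    case True
    then have "invertible (A - B ** 0)" by simp
    moreover have "dare_stabilizing_solution (rev_A 0) (rev_B 0) (rev_Q 0) (rev_S 0) (rev_R 0) P"
      using assms True unfolding rdare_iff by simp
    ultimately show ?thesis by (rule that)
  next
    case False
    then show ?thesis using that assms unfolding rdare_iff by auto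
  qed
  then show "psd (- (P + L))" "backward_value (- (P + L)) (- (P + L))"
    by (rule rdare_solution_fixpoint)+
qed

end

section \<open>Receding horizon control\<close>

text \<open>Summing the decrease bounds the total of \<open>a * (x j \<bullet> x j)\<close> by
  \<open>W (x 0)\<close>: each single term gives stability through \<open>upper\<close>, and
  summability gives attractivity.\<close>

lemma lyapunov_asymptotically_stable:
  fixes F :: "'a::real_inner \<Rightarrow> 'a" and W :: "'a \<Rightarrow> real"
  assumes a: "a > 0" and nonneg: "\<And>x. 0 \<le> W x" and upper: "\<And>x. W x \<le> c * (x \<bullet> x)"
    and dec: "\<And>x. W (F x) \<le> W x - a * (x \<bullet> x)"
  shows "origin_globally_asymptotically_stable (\<lambda>x. \<forall>j. x (Suc j) = F (x j))"
proof -
  have sum: "(\<Sum>j<k. a * (x j \<bullet> x j)) \<le> W (x 0)" if "\<forall>j. x (Suc j) = F (x j)" for x k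
  proof -
    have "(\<Sum>j<k. a * (x j \<bullet> x j)) + W (x k) \<le> W (x 0)"
    proof (induction k)
      case (Suc k)
      then show ?case using dec[of "x k"] that by simp
    qed simp
    then show ?thesis using nonneg[of "x k"] by linarith
  qed
  have bound: "a * (x j \<bullet> x j) \<le> c * (x 0 \<bullet> x 0)" if "\<forall>j. x (Suc j) = F (x j)" for x j
  proof -
    have "a * (x j \<bullet> x j) \<le> (\<Sum>j<Suc j. a * (x j \<bullet> x j))"
      using a by (simp add: sum_nonneg)
    then show ?thesis using sum[OF that, of "Suc j"] upper[of "x 0"] by linarith
  qed
  show ?thesis
    unfolding origin_globally_asymptotically_stable_def
  proof (intro conjI allI impI)
    fix r :: real assume "r > 0"
    \<comment> \<open>The constant \<open>c\<close> may have any sign, hence the positive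
      \<open>C\<close>; then \<open>d\<close> is chosen so that
      \<open>C * d^2 = a * r^2\<close>.\<close>
    define C where "C = \<bar>c\<bar> + 1"
    define d where "d = r * sqrt (a / C)"
    have "C > 0" by (simp add: C_def)
    then have "d > 0" using a \<open>r > 0\<close> by (simp add: d_def)
    moreover have "norm (x j) < r" if x: "\<forall>j. x (Suc j) = F (x j)" "norm (x 0) < d" for x j
    proof -
      have "(norm (x 0))\<^sup>2 < d\<^sup>2"
        using x(2) by (intro power_strict_mono) auto
      then have "C * (x 0 \<bullet> x 0) < C * d\<^sup>2"
        using \<open>C > 0\<close> by (simp add: power2_norm_eq_inner)
      moreover have "C * d\<^sup>2 = a * r\<^sup>2"
        using a \<open>C > 0\<close> by (simp add: d_def power_mult_distrib)
      moreover have "c * (x 0 \<bullet> x 0) \<le> C * (x 0 \<bullet> x 0)"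
        unfolding C_def by (intro mult_right_mono) auto
      ultimately have "a * (x j \<bullet> x j) < a * r\<^sup>2"
        using bound[OF x(1), of j] by linarith
      then have "(norm (x j))\<^sup>2 < r\<^sup>2" using a by (simp add: power2_norm_eq_inner)
      then show ?thesis using \<open>r > 0\<close> by (meson less_imp_le power2_less_imp_less)
    qed
    ultimately show "\<exists>d>0. \<forall>x. (\<forall>j. x (Suc j) = F (x j)) \<longrightarrow> norm (x 0) < d \<longrightarrow> (\<forall>j. norm (x j) < r)"
      by blast
  next
    fix x assume x: "\<forall>j. x (Suc j) = F (x j)"
    have "summable (\<lambda>j. a * (x j \<bullet> x j))"
      using a sum[OF x] by (intro summableI_nonneg_bounded[of _ "W (x 0)"]) auto
    then have "(\<lambda>j. a * (x j \<bullet> x j)) \<longlonglongrightarrow> 0" by (rule summable_LIMSEQ_zero)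
    then have "(\<lambda>j. sqrt (a * (x j \<bullet> x j) / a)) \<longlonglongrightarrow> sqrt (0 / a)"
      by (intro tendsto_intros) (use a in auto)
    then have "(\<lambda>j. norm (x j)) \<longlonglongrightarrow> 0" using a by (simp add: norm_eq_sqrt_inner)
    then show "x \<longlonglongrightarrow> 0" by (rule tendsto_norm_zero_cancel)
  qed
qed

lemma horizon_cost_Suc:
  "horizon_cost A B Q S R Pf (Suc N) x u =
     quadratic_cost Q S R x (u 0) + horizon_cost A B Q S R Pf N (A *v x + B *v u 0) (\<lambda>k. u (Suc k))"
  unfolding horizon_cost_def sum.lessThan_Suc_shift trajectory_shift
  by (simp add: stage_cost_eq_quadratic_cost trajectory_shift[simplified])

text \<open>The lower bound on the terminal cost with \<open>d > 0\<close> is preserved by the Riccati iteration and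
  leaves a fraction \<open>d\<close> of the rotated stage cost in every value function.\<close>

locale terminal_cost_lq = dissipative_lq A Q B S R L e
  for A Q :: "real^'x^'x" and B :: "real^'u^'x" and S :: "real^'x^'u" and R :: "real^'u^'u"
    and L :: "real^'x^'x" and e :: real +
  fixes Pf M :: "real^'x^'x" and d :: real
  assumes symPf: "symmetric_matrix Pf" and psdM: "psd M"
    and M_step: "(A *v x + B *v u) \<bullet> (M *v (A *v x + B *v u)) \<le> rotated x u + x \<bullet> (M *v x)"
    and d_pos: "0 < d" and d_less: "d < 1"
    and terminal_ge: "- (1 - d) * (x \<bullet> (M *v x)) \<le> x \<bullet> ((Pf + L) *v x)"
    and ctrl: "controllable A B"
begin

section \<open>Rotated value functions of the finite horizon problem\<close>

definition P :: "nat \<Rightarrow> real^'x^'x" where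
  "P n = riccati_iter A B Q S R Pf n"

definition val :: "nat \<Rightarrow> real^'x \<Rightarrow> real" where
  "val n x = x \<bullet> ((P n + L) *v x)"

definition K :: "nat \<Rightarrow> real^'x^'u" where
  "K n = riccati_gain A B S R (P n)"

definition T :: "nat \<Rightarrow> real^'u^'u" where
  "T n = R + transpose B ** P n ** B"

lemma P_Suc: "P (Suc n) = riccati_step A B Q S R (P n)"
  by (simp add: P_def)

lemma val_0 [simp]: "val n 0 = 0"
  by (simp add: val_def)

lemma hessian: "u \<bullet> (T n *v u) = rotated 0 u + val n (B *v u)"
  by (simp add: T_def val_def rotated_def quadratic_cost_def quadratic_form_simps inner_commute)

text \<open>The storage inequality at \<open>x = 0\<close> bounds \<open>M\<close> at
  \<open>B u\<close> by \<open>rotated 0 u\<close>, so at least \<open>d * rotated 0 u\<close>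
  survives. The lower bound is a premise because the lemma serves inside the induction that
  establishes it.\<close>

lemma hessian_pos_if:
  assumes "\<And>x. - (1 - d) * (x \<bullet> (M *v x)) \<le> val n x" "u \<noteq> 0"
  shows "0 < u \<bullet> (T n *v u)"
proof -
  have "(1 - d) * ((B *v u) \<bullet> (M *v (B *v u))) \<le> (1 - d) * rotated 0 u"
    using M_step[of 0 u] d_less by (intro mult_left_mono) auto
  moreover have "0 < d * rotated 0 u" using d_pos rotated_pos assms(2) by simp
  ultimately show ?thesis
    using assms(1)[of "B *v u"] by (simp add: hessian algebra_simps)
qed

lemma dynamic_programming_if:
  assumes "symmetric_matrix (P n)" "invertible (T n)"
  shows "rotated x u + val n (A *v x + B *v u) =
    val (Suc n) x + (u + K n *v x) \<bullet> (T n *v (u + K n *v x))"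
  using riccati_completion_of_squares[OF symR assms(1) assms(2)[unfolded T_def],
      where A = A and Q = Q and S = S and x = x and u = u]
  by (simp add: rotated_def val_def K_def T_def P_Suc matrix_vector_mult_add_rdistrib
      inner_add_right[of _ "P _ *v _"] inner_add_right[of _ "riccati_step _ _ _ _ _ _ *v _"])

text \<open>Symmetry and the lower bound need a joint induction: the bound makes \<open>T n\<close>
  positive definite, which makes the Riccati step meaningful, and dynamic programming then yields
  the next bound.\<close>

lemma riccati_invariant:
  "symmetric_matrix (P n) \<and> (\<forall>x. - (1 - d) * (x \<bullet> (M *v x)) \<le> val n x)"
proof (induction n)
  case 0
  then show ?case using symPf terminal_ge by (simp add: P_def val_def)
next
  case (Suc n)
  then have pos: "u \<noteq> 0 \<Longrightarrow> 0 < u \<bullet> (T n *v u)" for u by (intro hessian_pos_if) auto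
  then have inv: "invertible (T n)" by (intro invertible_if_definite) (metis less_irrefl)
  have aux: "- (1 - d) * a \<le> w"
    if "w = r + v" "- (1 - d) * m \<le> v" "(1 - d) * m \<le> (1 - d) * (r + a)" "0 \<le> d * r" for a m r v w
    using that by (simp add: algebra_simps)
  have "- (1 - d) * (x \<bullet> (M *v x)) \<le> val (Suc n) x" for x
  proof -
    let ?u = "- (K n *v x)"
    let ?y = "A *v x + B *v ?u"
    have "val (Suc n) x = rotated x ?u + val n ?y"
      using dynamic_programming_if[OF _ inv, of x ?u] Suc by simp
    moreover have "- (1 - d) * (?y \<bullet> (M *v ?y)) \<le> val n ?y" using Suc by blast
    moreover have "(1 - d) * (?y \<bullet> (M *v ?y)) \<le> (1 - d) * (rotated x ?u + x \<bullet> (M *v x))"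
      using d_less by (intro mult_left_mono M_step) auto
    moreover have "0 \<le> d * rotated x ?u" using d_pos rotated_nonneg by simp
    ultimately show ?thesis by (rule aux)
  qed
  moreover have "symmetric_matrix (P (Suc n))"
    unfolding P_Suc using Suc inv by (intro symmetric_riccati_step symQ symR) (auto simp: T_def)
  ultimately show ?case by blast
qed

lemma symmetric_P: "symmetric_matrix (P n)"
  using riccati_invariant by blast

lemma val_ge: "- (1 - d) * (x \<bullet> (M *v x)) \<le> val n x"
  using riccati_invariant by blast

lemma hessian_pos: "u \<noteq> 0 \<Longrightarrow> 0 < u \<bullet> (T n *v u)"
  by (intro hessian_pos_if val_ge)

lemma hessian_nonneg: "0 \<le> u \<bullet> (T n *v u)"
  using hessian_pos[of u n] by (cases "u = 0") auto

lemma invertible_T: "invertible (T n)"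
  by (intro invertible_if_definite) (metis hessian_pos less_irrefl)

lemmas dynamic_programming = dynamic_programming_if[OF symmetric_P invertible_T]

lemma val_Suc_le: "val (Suc n) x \<le> rotated x u + val n (A *v x + B *v u)"
  using hessian_nonneg unfolding dynamic_programming by simp

lemma val_Suc_feedback:
  "val (Suc n) x = rotated x (- (K n *v x)) + val n (A *v x + B *v (- (K n *v x)))"
  unfolding dynamic_programming by simp

subsection \<open>Optimal inputs\<close>

lemma quadratic_cost_step:
  "quadratic_cost Q S R x u + (A *v x + B *v u) \<bullet> (P n *v (A *v x + B *v u)) =
    x \<bullet> (P (Suc n) *v x) + (u + K n *v x) \<bullet> (T n *v (u + K n *v x))"
  using riccati_completion_of_squares[OF symR symmetric_P invertible_T[unfolded T_def]]
  by (simp add: P_Suc K_def T_def)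

lemma horizon_cost_ge: "x \<bullet> (P N *v x) \<le> horizon_cost A B Q S R Pf N x u"
proof (induction N arbitrary: x u)
  case 0
  then show ?case by (simp add: horizon_cost_def P_def)
next
  case (Suc N)
  show ?case
    unfolding horizon_cost_Suc
    using Suc[of "A *v x + B *v u 0" "\<lambda>k. u (Suc k)"] quadratic_cost_step[of x "u 0" N]
      hessian_nonneg[of "u 0 + K N *v x" N] by linarith
qed

lemma horizon_cost_attained: "\<exists>u. horizon_cost A B Q S R Pf N x u = x \<bullet> (P N *v x)"
proof (induction N arbitrary: x)
  case 0
  then show ?case by (simp add: horizon_cost_def P_def)
next
  case (Suc N)
  let ?w = "- (K N *v x)"
  obtain u where "horizon_cost A B Q S R Pf N (A *v x + B *v ?w) u =
      (A *v x + B *v ?w) \<bullet> (P N *v (A *v x + B *v ?w))"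
    using Suc by blast
  then have "horizon_cost A B Q S R Pf (Suc N) x (\<lambda>k. case k of 0 \<Rightarrow> ?w | Suc i \<Rightarrow> u i) = x \<bullet> (P (Suc N) *v x)"
    unfolding horizon_cost_Suc using quadratic_cost_step[of x ?w N] by simp
  then show ?case by blast
qed

lemma optimal_input_iff:
  "optimal_input A B Q S R Pf N x u \<longleftrightarrow> horizon_cost A B Q S R Pf N x u = x \<bullet> (P N *v x)"
proof
  assume "optimal_input A B Q S R Pf N x u"
  then have "\<not> horizon_cost A B Q S R Pf N x v < horizon_cost A B Q S R Pf N x u" for v
    by (simp add: optimal_input_def is_arg_min_def)
  then show "horizon_cost A B Q S R Pf N x u = x \<bullet> (P N *v x)"
    using horizon_cost_attained[of N x] horizon_cost_ge[of x N u] by (metis antisym_conv not_less)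
next
  assume "horizon_cost A B Q S R Pf N x u = x \<bullet> (P N *v x)"
  then show "optimal_input A B Q S R Pf N x u"
    using horizon_cost_ge by (simp add: optimal_input_def is_arg_min_def not_less)
qed

lemma optimal_input_exists: "\<exists>u. optimal_input A B Q S R Pf N x u"
  using horizon_cost_attained by (simp add: optimal_input_iff)

text \<open>Any other first input adds a strictly positive square, while the tail costs at least its
  value. Horizon \<open>Suc n\<close> uses \<open>K n\<close>, the gain formed from
  \<open>P n\<close>.\<close>

lemma optimal_input_first:
  assumes "optimal_input A B Q S R Pf (Suc n) x u"
  shows "u 0 = - (K n *v x)"
proof (rule ccontr)
  assume "u 0 \<noteq> - (K n *v x)"
  then have "u 0 + K n *v x \<noteq> 0" by (simp add: eq_neg_iff_add_eq_0)
  then have "0 < (u 0 + K n *v x) \<bullet> (T n *v (u 0 + K n *v x))" by (rule hessian_pos)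
  moreover have "horizon_cost A B Q S R Pf (Suc n) x u = x \<bullet> (P (Suc n) *v x)"
    using assms by (simp only: optimal_input_iff)
  ultimately show False
    using quadratic_cost_step[of x "u 0" n] horizon_cost_ge[of "A *v x + B *v u 0" n "\<lambda>k. u (Suc k)"]
    unfolding horizon_cost_Suc by linarith
qed

lemma receding_horizon_trajectory_iff:
  "receding_horizon_trajectory A B Q S R Pf (Suc n) xh \<longleftrightarrow> (\<forall>j. xh (Suc j) = (A - B ** K n) *v xh j)"
proof -
  have "(A - B ** K n) *v x = A *v x + B *v (- (K n *v x))" for x
    by (simp add: quadratic_form_simps)
  then show ?thesis
    unfolding receding_horizon_trajectory_def
    using optimal_input_exists optimal_input_first by metis
qed

subsection \<open>Stability\<close>

lemma val_le_path:
  assumes "\<And>j. j < k \<Longrightarrow> xs (Suc j) = A *v xs j + B *v us j"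
  shows "val (m + k) (xs 0) \<le> (\<Sum>j<k. rotated (xs j) (us j)) + val m (xs k)"
  using assms
proof (induction k arbitrary: m)
  case (Suc k)
  have "val (Suc m + k) (xs 0) \<le> (\<Sum>j<k. rotated (xs j) (us j)) + val (Suc m) (xs k)"
    using Suc by (intro Suc.IH) auto
  then show ?case
    using val_Suc_le[of m "xs k" "us k"] Suc.prems[of k] by simp
qed simp

lemma storage_le_path:
  assumes "\<And>j. j < k \<Longrightarrow> xs (Suc j) = A *v xs j + B *v us j"
  shows "xs k \<bullet> (M *v xs k) \<le> xs 0 \<bullet> (M *v xs 0) + (\<Sum>j<k. rotated (xs j) (us j))"
  using assms
proof (induction k)
  case (Suc k)
  then show ?case using M_step[of "xs k" "us k"] by simp
qed simp

text \<open>With \<open>N - j\<close> steps to go the minimizing gain is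
  \<open>K (N - Suc j)\<close>; the path is meaningful up to \<open>j = N\<close>.\<close>

primrec opt_path :: "nat \<Rightarrow> real^'x \<Rightarrow> nat \<Rightarrow> real^'x" where
  "opt_path N x 0 = x"
| "opt_path N x (Suc j) = A *v opt_path N x j + B *v (- (K (N - Suc j) *v opt_path N x j))"

definition opt_input :: "nat \<Rightarrow> real^'x \<Rightarrow> nat \<Rightarrow> real^'u" where
  "opt_input N x j = - (K (N - Suc j) *v opt_path N x j)"

lemma opt_path_Suc: "opt_path N x (Suc j) = A *v opt_path N x j + B *v opt_input N x j"
  by (simp add: opt_input_def)

lemma val_opt_path:
  "k \<le> N \<Longrightarrow> val N x = (\<Sum>j<k. rotated (opt_path N x j) (opt_input N x j)) + val (N - k) (opt_path N x k)"
proof (induction k)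
  case (Suc k)
  then have "N - k = Suc (N - Suc k)" by simp
  then have "val (N - k) (opt_path N x k) =
      rotated (opt_path N x k) (opt_input N x k) + val (N - Suc k) (opt_path N x (Suc k))"
    using val_Suc_feedback[of "N - Suc k" "opt_path N x k"] unfolding opt_path_Suc opt_input_def by simp
  then show ?case using Suc by simp
qed simp

text \<open>The final value is at least \<open>- (1 - d)\<close> times the final storage, and
  storage grows by at most the accumulated rotated cost; a fraction \<open>d\<close> of that cost is
  left over.\<close>

lemma opt_path_cost:
  assumes "k \<le> N"
  shows "d * (\<Sum>j<k. rotated (opt_path N x j) (opt_input N x j)) \<le> val N x + (1 - d) * (x \<bullet> (M *v x))"
proof -
  let ?s = "\<Sum>j<k. rotated (opt_path N x j) (opt_input N x j)" and ?y = "opt_path N x k"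
  have "?y \<bullet> (M *v ?y) \<le> x \<bullet> (M *v x) + ?s"
    using storage_le_path[of k "opt_path N x" "opt_input N x"] by (simp add: opt_input_def)
  then have "(1 - d) * (?y \<bullet> (M *v ?y)) \<le> (1 - d) * (x \<bullet> (M *v x) + ?s)"
    using d_less by (intro mult_left_mono) auto
  then show ?thesis
    using val_opt_path[OF assms, of x] val_ge[of ?y "N - k"] by (simp add: algebra_simps)
qed

text \<open>From above, steer to the origin in \<open>CARD('x)\<close> steps, where the remaining
  value is 0; from below, use \<open>val_ge\<close>. Pointwise bounds then become uniform.\<close>

lemma val_uniform_bound:
  obtains c where "c > 0" "\<And>n x. n \<ge> CARD('x) \<Longrightarrow> \<bar>val n x\<bar> \<le> c * (x \<bullet> x)"
proof -
  have "\<exists>c. \<forall>n. \<bar>x \<bullet> ((P (n + CARD('x)) + L) *v x)\<bar> \<le> c" for x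
  proof -
    obtain u where u: "trajectory A B x u CARD('x) = 0" by (rule controllable_null[OF ctrl])
    let ?c = "\<Sum>j<CARD('x). rotated (trajectory A B x u j) (u j)"
    have "val (n + CARD('x)) x \<le> ?c" for n
      using val_le_path[of "CARD('x)" "trajectory A B x u" u n] by (simp add: u)
    moreover have "- ((1 - d) * (x \<bullet> (M *v x))) \<le> val n x" for n
      using val_ge[of x n] by (simp only: mult_minus_left)
    ultimately have "\<bar>val (n + CARD('x)) x\<bar> \<le> max ?c ((1 - d) * (x \<bullet> (M *v x)))" for n
      by (simp add: abs_le_iff max.coboundedI1 max.coboundedI2 minus_le_iff)
    then show ?thesis unfolding val_def by blast
  qed
  moreover have "symmetric_matrix (P n + L)" for n
    by (intro symmetric_matrix_add symmetric_P symL)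
  ultimately obtain c where c: "c > 0" "\<And>n x. \<bar>x \<bullet> ((P (n + CARD('x)) + L) *v x)\<bar> \<le> c * (x \<bullet> x)"
    using symmetric_matrices_uniform_bound[of "\<lambda>n. P (n + CARD('x)) + L"] by blast
  have "\<bar>val n x\<bar> \<le> c * (x \<bullet> x)" if "n \<ge> CARD('x)" for n x
    using c(2)[of x "n - CARD('x)"] that by (simp add: val_def)
  then show ?thesis using c(1) that by blast
qed

lemma val_storage_bound:
  obtains c where "c > 0" "\<And>n x. n \<ge> CARD('x) \<Longrightarrow> \<bar>val n x\<bar> \<le> c * (x \<bullet> x)"
    "\<And>n x. n \<ge> CARD('x) \<Longrightarrow> val n x + (1 - d) * (x \<bullet> (M *v x)) \<le> c * (x \<bullet> x)"
proof -
  obtain c where c: "c > 0" "\<And>n x. n \<ge> CARD('x) \<Longrightarrow> \<bar>val n x\<bar> \<le> c * (x \<bullet> x)"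
    by (rule val_uniform_bound) (rule that)
  have M: "(1 - d) * (x \<bullet> (M *v x)) \<le> norm M * (x \<bullet> x)" for x
  proof -
    have "(1 - d) * (x \<bullet> (M *v x)) \<le> 1 * (x \<bullet> (M *v x))"
      using d_pos psdM by (intro mult_right_mono) (auto simp: psd_def)
    then show ?thesis using abs_quadratic_form_le[of x M] by linarith
  qed
  show ?thesis
  proof (rule that[of "c + norm M"])
    show "c + norm M > 0" using c(1) by (simp add: add_pos_nonneg)
    fix n and x :: "real^'x" assume n: "n \<ge> CARD('x)"
    have "0 \<le> norm M * (x \<bullet> x)" by simp
    then show "\<bar>val n x\<bar> \<le> (c + norm M) * (x \<bullet> x)"
      unfolding distrib_right using c(2)[OF n, of x] by linarith
    show "val n x + (1 - d) * (x \<bullet> (M *v x)) \<le> (c + norm M) * (x \<bullet> x)"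
      using c(2)[OF n, of x] M[of x] by (simp add: distrib_right)
  qed
qed

text \<open>An optimal path has bounded total rotated cost, so one of its first \<open>k\<close> states is of
  squared norm \<open>O(1/k)\<close>; inserting one more time step there changes the value by as little.\<close>

lemma val_increment:
  assumes "h > 0"
  obtains n0 where "\<And>n x. n \<ge> n0 \<Longrightarrow> val (Suc n) x \<le> val n x + h * (x \<bullet> x)"
proof -
  obtain c where c: "c > 0" "\<And>n x. n \<ge> CARD('x) \<Longrightarrow> \<bar>val n x\<bar> \<le> c * (x \<bullet> x)"
    "\<And>n x. n \<ge> CARD('x) \<Longrightarrow> val n x + (1 - d) * (x \<bullet> (M *v x)) \<le> c * (x \<bullet> x)"
    by (rule val_storage_bound) (rule that)
  \<comment> \<open>This size makes \<open>2 * c\<close> times the squared norm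
    \<open>c * (x \<bullet> x) / (d * e * k)\<close> of a small state at most
    \<open>h * (x \<bullet> x)\<close>.\<close>
  obtain k :: nat where k: "2 * c * c / (d * e * h) < k" using reals_Archimedean2 by blast
  have de: "d * e > 0" using d_pos e_pos by simp
  have "0 < 2 * c * c / (d * e * h)" using c(1) de assms by simp
  then have kpos: "real k > 0" using k by linarith
  have "2 * c * c < h * (d * e * real k)"
  proof -
    have "d * e * h > 0" using de assms by simp
    then have "2 * c * c < real k * (d * e * h)"
      using k by (simp only: pos_divide_less_eq)
    then show ?thesis by (simp only: mult_ac)
  qed
  have "val (Suc n) x \<le> val n x + h * (x \<bullet> x)" if n: "n \<ge> CARD('x) + k" for n x
  proof -
    let ?x = "opt_path n x" and ?u = "opt_input n x"
    \<comment> \<open>Averaging: if all \<open>k\<close> states were larger, their rotated costs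
      would exceed the bound of \<open>opt_path_cost\<close>.\<close>
    have "\<exists>j<k. d * e * real k * (?x j \<bullet> ?x j) \<le> c * (x \<bullet> x)"
    proof (rule ccontr)
      assume "\<not> ?thesis"
      then have "c * (x \<bullet> x) < d * e * real k * (?x j \<bullet> ?x j)" if "j < k" for j
        using that by force
      then have "(\<Sum>j<k. c * (x \<bullet> x)) < (\<Sum>j<k. d * e * real k * (?x j \<bullet> ?x j))"
        using kpos by (intro sum_strict_mono) auto
      then have "real k * (c * (x \<bullet> x)) < real k * (d * (\<Sum>j<k. e * (?x j \<bullet> ?x j)))"
        by (simp add: sum_distrib_left mult_ac)
      then have "c * (x \<bullet> x) < d * (\<Sum>j<k. e * (?x j \<bullet> ?x j))"
        using kpos by simp
      also have "\<dots> \<le> d * (\<Sum>j<k. rotated (?x j) (?u j))"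
        using d_pos by (intro mult_left_mono sum_mono rotated_ge_x) auto
      also have "\<dots> \<le> c * (x \<bullet> x)"
        using opt_path_cost[of k n x] c(3)[of n x] n by linarith
      finally show False by simp
    qed
    then obtain j where j: "j < k" "d * e * real k * (?x j \<bullet> ?x j) \<le> c * (x \<bullet> x)" by blast
    \<comment> \<open>Follow the optimal path for \<open>j\<close> steps, then continue with one
      step more to go than planned. As \<open>n - j \<ge> CARD('x)\<close>, both remaining values
      are at most \<open>c * (?x j \<bullet> ?x j)\<close> in size.\<close>
    have "val (Suc (n - j) + j) x \<le> (\<Sum>i<j. rotated (?x i) (?u i)) + val (Suc (n - j)) (?x j)"
      using val_le_path[of j ?x ?u "Suc (n - j)"] by (simp add: opt_input_def)
    moreover have "val n x = (\<Sum>i<j. rotated (?x i) (?u i)) + val (n - j) (?x j)"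
      using j n by (intro val_opt_path) auto
    moreover have "\<bar>val (Suc (n - j)) (?x j)\<bar> \<le> c * (?x j \<bullet> ?x j)" "\<bar>val (n - j) (?x j)\<bar> \<le> c * (?x j \<bullet> ?x j)"
      using j n by (auto intro!: c(2))
    ultimately have "val (Suc n) x \<le> val n x + 2 * c * (?x j \<bullet> ?x j)"
      using j n by simp
    moreover have "2 * c * (?x j \<bullet> ?x j) \<le> h * (x \<bullet> x)"
    proof -
      have "(d * e * real k) * (2 * c * (?x j \<bullet> ?x j)) = 2 * c * (d * e * real k * (?x j \<bullet> ?x j))"
        by simp
      also have "\<dots> \<le> 2 * c * (c * (x \<bullet> x))"
        using c(1) j(2) by (intro mult_left_mono) auto
      also have "\<dots> = (2 * c * c) * (x \<bullet> x)" by simp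
      also have "\<dots> \<le> (h * (d * e * real k)) * (x \<bullet> x)"
        using \<open>2 * c * c < h * (d * e * real k)\<close> by (intro mult_right_mono) auto
      also have "\<dots> = (d * e * real k) * (h * (x \<bullet> x))" by simp
      finally show ?thesis
        using de kpos by (metis mult_le_cancel_left_pos mult_pos_pos)
    qed
    ultimately show ?thesis by linarith
  qed
  then show ?thesis using that by blast
qed

text \<open>With \<open>r\<close> the rotated cost of the current step, \<open>?W\<close> changes by
  at most \<open>- r + d / 2 * r + (1 - d) * r = - d / 2 * r\<close>: value spent, horizon restored
  by \<open>val_increment\<close>, storage gained.\<close>

lemma closed_loop_stable:
  obtains n0 where "\<And>n. n \<ge> n0 \<Longrightarrow>
    origin_globally_asymptotically_stable (\<lambda>xh. \<forall>j. xh (Suc j) = (A - B ** K n) *v xh j)"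
proof -
  define g where "g = 2 * (norm A)\<^sup>2 + 2 * (norm B)\<^sup>2 + 1"
  have g: "g > 0" by (simp add: g_def add_nonneg_pos)
  have next_bound: "(A *v x + B *v u) \<bullet> (A *v x + B *v u) \<le> g * (x \<bullet> x + u \<bullet> u)" for x u
  proof -
    have "(norm (A *v x + B *v u))\<^sup>2 \<le> (norm A * norm x + norm B * norm u)\<^sup>2"
      using norm_triangle_ineq[of "A *v x" "B *v u"] norm_matrix_vector_le[of A x] norm_matrix_vector_le[of B u]
      by (intro power_mono) auto
    also have "\<dots> \<le> 2 * (norm A * norm x)\<^sup>2 + 2 * (norm B * norm u)\<^sup>2"
      using sum_squares_bound[of "norm A * norm x" "norm B * norm u"] by (simp add: power2_sum)
    also have "\<dots> = 2 * (norm A)\<^sup>2 * (x \<bullet> x) + 2 * (norm B)\<^sup>2 * (u \<bullet> u)"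
      by (simp add: power_mult_distrib power2_norm_eq_inner)
    also have "\<dots> \<le> g * (x \<bullet> x) + g * (u \<bullet> u)"
      by (intro add_mono mult_right_mono) (auto simp: g_def)
    finally show ?thesis by (simp add: power2_norm_eq_inner distrib_left)
  qed
  \<comment> \<open>Chosen so that \<open>h\<close> times the squared norm of the successor is at
    most \<open>d / 2\<close> times the rotated cost.\<close>
  define h where "h = d * e / (2 * g)"
  have h: "h > 0" using d_pos e_pos g by (simp add: h_def)
  obtain n1 where n1: "\<And>n x. n \<ge> n1 \<Longrightarrow> val (Suc n) x \<le> val n x + h * (x \<bullet> x)"
    by (rule val_increment[OF h]) (rule that)
  obtain c where c: "\<And>n x. n \<ge> CARD('x) \<Longrightarrow> val n x + (1 - d) * (x \<bullet> (M *v x)) \<le> c * (x \<bullet> x)"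
    by (rule val_storage_bound) (rule that)
  show ?thesis
  proof (rule that[of "n1 + CARD('x)"])
    fix n assume n: "n \<ge> n1 + CARD('x)"
    let ?W = "\<lambda>x. val (Suc n) x + (1 - d) * (x \<bullet> (M *v x))"
    show "origin_globally_asymptotically_stable (\<lambda>xh. \<forall>j. xh (Suc j) = (A - B ** K n) *v xh j)"
    proof (rule lyapunov_asymptotically_stable[of "d * e / 2" ?W c])
      show "d * e / 2 > 0" using d_pos e_pos by simp
    next
      fix x
      show "0 \<le> ?W x" using val_ge[of x "Suc n"] by (simp add: algebra_simps)
      show "?W x \<le> c * (x \<bullet> x)" using n by (intro c) simp
      let ?u = "- (K n *v x)"
      let ?y = "A *v x + B *v ?u"
      have y: "(A - B ** K n) *v x = ?y" by (simp add: quadratic_form_simps)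
      have "h * (?y \<bullet> ?y) \<le> h * (g * (x \<bullet> x + ?u \<bullet> ?u))"
        using h by (intro mult_left_mono next_bound) auto
      also have "\<dots> = d / 2 * (e * (x \<bullet> x + ?u \<bullet> ?u))" using g by (simp add: h_def)
      also have "\<dots> \<le> d / 2 * rotated x ?u"
        using d_pos by (intro mult_left_mono rotated_ge) auto
      finally have "val (Suc n) ?y \<le> val n ?y + d / 2 * rotated x ?u"
        using n1[of n ?y] n by simp
      moreover have "(1 - d) * (?y \<bullet> (M *v ?y)) \<le> (1 - d) * (rotated x ?u + x \<bullet> (M *v x))"
        using d_less by (intro mult_left_mono M_step) auto
      moreover have "val (Suc n) x = rotated x ?u + val n ?y" by (rule val_Suc_feedback)
      moreover have "d / 2 * (e * (x \<bullet> x)) \<le> d / 2 * rotated x ?u"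
        using d_pos by (intro mult_left_mono rotated_ge_x) auto
      ultimately have "?W ?y \<le> ?W x - d * e / 2 * (x \<bullet> x)"
        by (simp add: algebra_simps)
      then show "?W ((A - B ** K n) *v x) \<le> ?W x - d * e / 2 * (x \<bullet> x)"
        by (simp only: y)
    qed
  qed
qed

end

section \<open>From the certificate and the terminal margin to the receding horizon loop\<close>

theorem mainTheorem1:
  fixes A Q :: "real^'x^'x" and B :: "real^'u^'x" and S :: "real^'x^'u" and R :: "real^'u^'u"
  assumes "symmetric_matrix (cost_matrix Q S R)"
    and "strictly_xu_pre_dissipative A B Q S R"
    and "controllable A B"
  shows "(\<exists>!Ps. rdare_stabilizing_solution A B Q S R Ps) \<and>
    (\<forall>Ps Pf. rdare_stabilizing_solution A B Q S R Ps \<longrightarrow>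
       symmetric_matrix Pf \<longrightarrow> pos_def (Pf - Ps) \<longrightarrow>
       (\<exists>N0\<ge>1. \<forall>N\<ge>N0.
          (\<forall>n<N. invertible (R + transpose B ** riccati_iter A B Q S R Pf n ** B)) \<and>
          (\<forall>x. (\<exists>u. optimal_input A B Q S R Pf N x u) \<and>
               (\<forall>u. optimal_input A B Q S R Pf N x u \<longrightarrow>
                    u 0 = - (horizon_gain A B Q S R Pf N *v x))) \<and>
          (\<forall>xh. receding_horizon_trajectory A B Q S R Pf N xh \<longleftrightarrow>
                (\<forall>j. xh (Suc j) = (A - B ** horizon_gain A B Q S R Pf N) *v xh j)) \<and>
          origin_globally_asymptotically_stable (receding_horizon_trajectory A B Q S R Pf N)))"
proof -
  obtain L where L: "symmetric_matrix L" "pos_def (rotated_cost_matrix A B Q S R L)"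
    using assms(2) by (auto simp: strictly_xu_pre_dissipative_def)
  obtain e where e: "e > 0" "\<And>z. e * (z \<bullet> z) \<le> z \<bullet> (rotated_cost_matrix A B Q S R L *v z)"
    by (rule pos_def_lower_bound[OF L(2)]) (rule that)
  interpret dissipative_lq A Q B S R L e
  proof
    fix x u
    show "e * (x \<bullet> x + u \<bullet> u) \<le>
      quadratic_cost Q S R x u + x \<bullet> (L *v x) - (A *v x + B *v u) \<bullet> (L *v (A *v x + B *v u))"
      using e(2)[of "stack x u"] by (simp only: rotated_cost[OF L(1)] stack_inner)
  qed (use symmetric_cost_matrix[OF assms(1)] L(1) e(1) in simp_all)
  show ?thesis
  proof (intro conjI allI impI)
    show "\<exists>!Ps. rdare_stabilizing_solution A B Q S R Ps"
      by (rule rdare_solution_exists1[OF assms(3)])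
  next
    fix Ps Pf
    assume Ps: "rdare_stabilizing_solution A B Q S R Ps" and Pf: "symmetric_matrix Pf"
      and pd: "pos_def (Pf - Ps)"
    define M where "M = - (Ps + L)"
    have M: "psd M" "backward_value M M"
      unfolding M_def by (intro rdare_stabilizing_solution_fixpoint Ps)+
    obtain a where a: "a > 0" "\<And>x. a * (x \<bullet> x) \<le> x \<bullet> ((Pf - Ps) *v x)"
      by (rule pos_def_lower_bound[OF pd]) (rule that)
    define b where "b = norm M + 1"
    have b: "b > 0" by (simp add: b_def add_nonneg_pos)
    \<comment> \<open>Since \<open>Pf - Ps = (Pf + L) + M\<close> and \<open>b\<close> dominates
      \<open>M\<close>, the condition \<open>d * b \<le> a\<close> lets the margin \<open>a\<close>
      absorb \<open>d * M\<close>, which is the bound required of the terminal cost.\<close>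
    define d where "d = min (1 / 2) (a / b)"
    have d: "0 < d" "d < 1" using a(1) b by (auto simp: d_def)
    interpret terminal_cost_lq A Q B S R L e Pf M d
    proof
      fix x
      have "d * b \<le> a" using b by (simp add: d_def min_def field_simps)
      have "x \<bullet> (M *v x) \<le> b * (x \<bullet> x)"
        using abs_quadratic_form_le[of x M] by (simp add: b_def distrib_right add_increasing2)
      then have "d * (x \<bullet> (M *v x)) \<le> d * (b * (x \<bullet> x))"
        using d(1) by (intro mult_left_mono) auto
      also have "\<dots> \<le> a * (x \<bullet> x)"
        using \<open>d * b \<le> a\<close> by (simp add: mult.assoc[symmetric] mult_right_mono)
      also have "\<dots> \<le> x \<bullet> ((Pf - Ps) *v x)" by (rule a(2))
      also have "\<dots> = x \<bullet> ((Pf + L) *v x) + x \<bullet> (M *v x)"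
        by (simp add: M_def quadratic_form_simps)
      finally show "- (1 - d) * (x \<bullet> (M *v x)) \<le> x \<bullet> ((Pf + L) *v x)"
        by (simp add: algebra_simps)
    qed (use M d Pf assms(3) in \<open>auto simp: backward_value_def\<close>)
    have gain: "horizon_gain A B Q S R Pf (Suc n) = K n" for n
      by (simp add: horizon_gain_def K_def P_def)
    obtain n0 where n0: "\<And>n. n \<ge> n0 \<Longrightarrow>
      origin_globally_asymptotically_stable (\<lambda>xh. \<forall>j. xh (Suc j) = (A - B ** K n) *v xh j)"
      by (rule closed_loop_stable) (rule that)
    show "\<exists>N0\<ge>1. \<forall>N\<ge>N0.
          (\<forall>n<N. invertible (R + transpose B ** riccati_iter A B Q S R Pf n ** B)) \<and>
          (\<forall>x. (\<exists>u. optimal_input A B Q S R Pf N x u) \<and>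
               (\<forall>u. optimal_input A B Q S R Pf N x u \<longrightarrow>
                    u 0 = - (horizon_gain A B Q S R Pf N *v x))) \<and>
          (\<forall>xh. receding_horizon_trajectory A B Q S R Pf N xh \<longleftrightarrow>
                (\<forall>j. xh (Suc j) = (A - B ** horizon_gain A B Q S R Pf N) *v xh j)) \<and>
          origin_globally_asymptotically_stable (receding_horizon_trajectory A B Q S R Pf N)"
    \<comment> \<open>The shift by one reflects that horizon \<open>Suc n\<close> applies the gain
      \<open>K n\<close>.\<close>
    proof (intro exI[of _ "Suc n0"] conjI allI impI)
      show "1 \<le> Suc n0" by simp
    next
      fix N n
      show "invertible (R + transpose B ** riccati_iter A B Q S R Pf n ** B)"
        using invertible_T[of n] by (simp add: T_def P_def)
    next
      fix N x
      show "\<exists>u. optimal_input A B Q S R Pf N x u" by (rule optimal_input_exists)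
    next
      fix N x u assume "Suc n0 \<le> N" and u: "optimal_input A B Q S R Pf N x u"
      then obtain n where "N = Suc n" by (metis Suc_le_D)
      then show "u 0 = - (horizon_gain A B Q S R Pf N *v x)"
        using optimal_input_first u by (simp add: gain)
    next
      fix N xh assume "Suc n0 \<le> N"
      then obtain n where "N = Suc n" by (metis Suc_le_D)
      then show "receding_horizon_trajectory A B Q S R Pf N xh \<longleftrightarrow>
          (\<forall>j. xh (Suc j) = (A - B ** horizon_gain A B Q S R Pf N) *v xh j)"
        by (simp only: gain receding_horizon_trajectory_iff)
    next
      fix N assume "Suc n0 \<le> N"
      then obtain n where n: "N = Suc n" "n0 \<le> n" by (metis Suc_le_D Suc_le_mono)
      have "receding_horizon_trajectory A B Q S R Pf N = (\<lambda>xh. \<forall>j. xh (Suc j) = (A - B ** K n) *v xh j)"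
        by (rule ext) (simp only: n receding_horizon_trajectory_iff)
      then show "origin_globally_asymptotically_stable (receding_horizon_trajectory A B Q S R Pf N)"
        using n0[OF n(2)] by (simp only:)
    qed
  qed
qed

end
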